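(* The solution of the Bagley-Torvik equation $$a\,y''(t)+b\;{}_{0}^{\ast}D_{t}^{3/2}y(t)+c\,y(t)=\sum_{\ell=0}^{n}C_\ell\,t^{\alpha_\ell},\qquad t>0,$$ with $a,b,c,C_\ell,\alpha_\ell\in\mathbb{R}$ and initial conditions $y(0),y'(0)\in\mathbb{R}$, is given by $$y(t)=y_f(t)+y_c(t),$$ where $$y_c(t)=\sum_{k=1}^{4}\frac{(a\,r_k+b)\left[r_k^2\,y(0)+y'(0)\right]}{(4a\,r_k+3b)\,r_k^2}\exp(r_k^2t)\,\mathrm{erfc}(-r_k\sqrt{t})$$ and $$y_f(t)=\sum_{\ell=0}^{n}C_\ell\,\Gamma(\alpha_\ell+1)\,t^{1/2+\alpha_\ell}\sum_{k=1}^{4}\frac{\mathrm{E}_{1/2,\,3/2+\alpha_\ell}\left(r_k\sqrt{t}\right)}{4a\,r_k^3+3b\,r_k^2},$$ and where $r_k$ $(k=1,2,3,4)$ are the $4$ different roots of the polynomial $P(r)=a\,r^{4}+b\,r^{3}+c$, which are given by $$r_{1,2}=-\frac{\beta}{4}\pm R+T_{\pm},\qquad r_{3,4}=-\frac{\beta}{4}\pm R-T_{\pm},$$ where $$\beta=\frac{b}{a},\quad \gamma=\frac{c}{a},\quad \delta=\left(9\beta^2+\sqrt{81\beta^4-768\gamma}\right)\gamma,$$ $$R=\frac12\sqrt{\left(\frac{\beta}{2}\right)^2+\left(\frac{\delta}{18}\right)^{1/3}+\frac{8\gamma}{(12\delta)^{1/3}}},$$ $$T_{\pm}=\frac12\s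qrt{\frac{\beta^2}{2}-4\gamma\left(\frac{2}{3\delta}\right)^{1/3}-\left(\frac{\delta}{18}\right)^{1/3}\mp\frac{\beta^3}{8R}}.$$
   Context: The Caputo fractional derivative of order $3/2$ is $${}_{0}^{\ast}D_{t}^{3/2}g(t)=\frac{1}{\Gamma(1/2)}\int_0^t\frac{g''(\tau)}{(t-\tau)^{1/2}}\,d\tau ,$$ where $\Gamma$ is the gamma function. The complementary error function is $\mathrm{erfc}(z)=1-\frac{2}{\sqrt{\pi}}\int_0^z e^{-u^2}\,du$, for complex $z$. The two-parameter Mittag-Leffler function is $$\mathrm{E}_{\alpha,\beta}(z)=\sum_{k=0}^{\infty}\frac{z^{k}}{\Gamma(\alpha k+\beta)},\qquad \mathrm{Re}\,\alpha>0,\ \beta\in\mathbb{C}.$$ Here $n$ is a nonnegative integer and $\ell=0,\ldots,n$.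
   Formalization: Existence of the solution is claimed only when all α_ℓ > -1 (it fails otherwise unless terms cancel); roots are principal, with (2/(3δ))^{1/3} taken as 2^{1/3}/(3δ)^{1/3}, since for c/a < 0 its principal value does not give roots. *)

theory Defs
  imports "HOL-Complex_Analysis.Complex_Analysis"
begin

definition caputo_three_halves :: "(real \<Rightarrow> real) \<Rightarrow> real \<Rightarrow> real" where
  "caputo_three_halves g t =
     1 / Gamma (1/2) * (LINT \<tau>:{0<..<t}|lborel. deriv (deriv g) \<tau> / (t - \<tau>) powr (1/2))"

(* The integrand is entire, so the straight path from 0 to z computes the integral. *)
definition erfc :: "complex \<Rightarrow> complex" where
  "erfc z = 1 - 2 / of_real (sqrt pi) * contour_integral (linepath 0 z) (\<lambda>u. exp (- (u\<^sup>2)))"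

(* Where a * k + b is a pole of Gamma, Gamma (a * k + b) = 0 and the summand is 0,
   in agreement with the usual convention 1 / Gamma = 0 at the poles. *)
definition mittag_leffler :: "complex \<Rightarrow> complex \<Rightarrow> complex \<Rightarrow> complex" where
  "mittag_leffler a b z = (\<Sum>k. z ^ k / Gamma (a * of_nat k + b))"

(* y solves a y'' + b D^(3/2) y + c y = f on t > 0 with y(0) = y0, y'(0) = y1.
   The integrability condition says that the Caputo derivative exists.
   The derivative at 0 is one-sided; values of y at negative arguments are irrelevant. *)
definition bagley_torvik_solution ::
    "real \<Rightarrow> real \<Rightarrow> real \<Rightarrow> (real \<Rightarrow> real) \<Rightarrow> real \<Rightarrow> real \<Rightarrow> (real \<Rightarrow> real) \<Rightarrow> bool" where
  "bagley_torvik_solution a b c f y0 y1 y \<longleftrightarrow>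
     y 0 = y0 \<and> (y has_real_derivative y1) (at 0 within {0..}) \<and>
     (\<forall>t>0. y differentiable at t \<and> deriv y differentiable at t \<and>
        set_integrable lborel {0<..<t} (\<lambda>\<tau>. deriv (deriv y) \<tau> / (t - \<tau>) powr (1/2)) \<and>
        a * deriv (deriv y) t + b * caputo_three_halves y t + c * y t = f t)"

definition bt_poly :: "real \<Rightarrow> real \<Rightarrow> real \<Rightarrow> complex poly" where
  "bt_poly a b c = monom (of_real a) 4 + monom (of_real b) 3 + monom (of_real c) 0"

abbreviation (input) cbrt :: "complex \<Rightarrow> complex" where
  "cbrt z \<equiv> z powr (1/3)"

definition bt_delta :: "complex \<Rightarrow> complex \<Rightarrow> complex" where
  "bt_delta \<beta> \<gamma> = (9 * \<beta>\<^sup>2 + csqrt (81 * \<beta>^4 - 768 * \<gamma>)) * \<gamma>"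

definition bt_R :: "complex \<Rightarrow> complex \<Rightarrow> complex" where
  "bt_R \<beta> \<gamma> = (let \<delta> = bt_delta \<beta> \<gamma> in
     1/2 * csqrt ((\<beta> / 2)\<^sup>2 + cbrt (\<delta> / 18) + 8 * \<gamma> / cbrt (12 * \<delta>)))"

(* T_+ for s = 1 and T_- for s = -1.
   (2 / (3 \<delta>))^(1/3) is read as the quotient of cube roots cbrt 2 / cbrt (3 \<delta>), so that
   all cube roots come from one branch of \<delta>^(1/3). This differs from cbrt (2 / (3 \<delta>)) only
   for negative real \<delta> (i.e. \<gamma> < 0), where the principal cube root does not commute with
   inversion and the formula would not give roots. Taking real cube roots of negative \<delta>
   would not do either: it makes R = 0 when \<beta> = 0 and \<gamma> < 0. *)
definition bt_T :: "complex \<Rightarrow> complex \<Rightarrow> complex \<Rightarrow> complex" where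
  "bt_T s \<beta> \<gamma> = (let \<delta> = bt_delta \<beta> \<gamma> in
     1/2 * csqrt (\<beta>\<^sup>2 / 2 - 4 * \<gamma> * (cbrt 2 / cbrt (3 * \<delta>)) - cbrt (\<delta> / 18)
                  - s * (\<beta>^3 / (8 * bt_R \<beta> \<gamma>))))"

(* Numbering for k = 1, 2, 3, 4; the value at other k is irrelevant. *)
definition bt_root :: "real \<Rightarrow> real \<Rightarrow> real \<Rightarrow> nat \<Rightarrow> complex" where
  "bt_root a b c k = (let \<beta> = of_real (b / a); \<gamma> = of_real (c / a); R = bt_R \<beta> \<gamma> in
     if k = 1 then - \<beta> / 4 + R + bt_T 1 \<beta> \<gamma>
     else if k = 2 then - \<beta> / 4 - R + bt_T (- 1) \<beta> \<gamma>
     else if k = 3 then - \<beta> / 4 + R - bt_T 1 \<beta> \<gamma>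
     else - \<beta> / 4 - R - bt_T (- 1) \<beta> \<gamma>)"

definition bt_complementary ::
    "real \<Rightarrow> real \<Rightarrow> real \<Rightarrow> real \<Rightarrow> real \<Rightarrow> real \<Rightarrow> complex" where
  "bt_complementary a b c y0 y1 t = (\<Sum>k=1..4. let r = bt_root a b c k in
     (of_real a * r + of_real b) * (r\<^sup>2 * of_real y0 + of_real y1)
       / ((4 * of_real a * r + 3 * of_real b) * r\<^sup>2)
     * exp (r\<^sup>2 * of_real t) * erfc (- r * of_real (sqrt t)))"

definition bt_forced ::
    "real \<Rightarrow> real \<Rightarrow> real \<Rightarrow> nat \<Rightarrow> (nat \<Rightarrow> real) \<Rightarrow> (nat \<Rightarrow> real) \<Rightarrow> real \<Rightarrow> complex" where
  "bt_forced a b c n C \<alpha> t = (\<Sum>l=0..n.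
     of_real (C l * Gamma (\<alpha> l + 1) * t powr (1/2 + \<alpha> l)) *
     (\<Sum>k=1..4. let r = bt_root a b c k in
        mittag_leffler (1/2) (3/2 + of_real (\<alpha> l)) (r * of_real (sqrt t))
          / (4 * of_real a * r^3 + 3 * of_real b * r\<^sup>2)))"

end

theory Submission
  imports Defs
begin

text \<open>
  Put \<open>u = y''\<close>.  The Caputo derivative of order \<open>3/2\<close> of \<open>y\<close> is the half integral \<open>J u\<close>, and \<open>y\<close> itself
  is \<open>y0 + y1 t + J\<^sup>4 u\<close>.  So the initial value problem says
  \<open>(a + b J + c J\<^sup>4) u = f - c y0 - c y1 t\<close>, and it is solved by expanding the inverse of
  \<open>a + b X + c X\<^sup>4\<close> into powers of \<open>X\<close>.  Since \<open>a + b X + c X\<^sup>4 = X\<^sup>4 P(1/X)\<close>, partial fractions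
  of \<open>1/P\<close> show that the coefficient of \<open>X\<^sup>j\<close> is \<open>s (j + 3)\<close>, where
  \<open>s j = \<Sum>k. r\<^sub>k\<^sup>j / P'(r\<^sub>k)\<close>; these numbers are real although the roots need not be, and
  \<open>s 0 = s 1 = s 2 = 0\<close>, \<open>a s 3 = 1\<close>, \<open>a s (j+4) + b s (j+3) + c s j = 0\<close> (\<open>bt_moment_rec\<close>).

  By Euler's beta integral, half integration sends \<open>t\<^sup>\<beta> / \<Gamma>(\<beta> + 1)\<close> to the same expression with
  \<open>\<beta> + 1/2\<close> in place of \<open>\<beta>\<close>.  Hence the response to a power of \<open>t\<close> is a power series in the square root of \<open>t\<close>
  times a power of \<open>t\<close> (\<open>power_source_solution\<close>), and linearity gives a solution for all sources and
  initial values (\<open>explicit_solution\<close>).  Substituting the definition of \<open>s j\<close> and exchanging the two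
  sums turns the series into Mittag-Leffler functions at \<open>r\<^sub>k\<close> times the square root of \<open>t\<close>.  For the
  part coming from the initial values the parameters are \<open>1/2\<close> and \<open>1\<close>, and that function is
  \<open>exp (z\<^sup>2) erfc (- z)\<close> (\<open>exp_erfc_eq_mittag_leffler\<close>).

  Uniqueness (\<open>bagley_torvik_solution_unique\<close>): if \<open>w\<close> is the second derivative of the difference of
  two solutions, the equation bounds \<open>|w|\<close> on a bounded interval by a multiple of the half integral
  of \<open>|w|\<close>.  In the \<open>L\<^sup>1\<close> norm with weight \<open>exp (- \<mu> t)\<close> half integration has norm at most
  \<open>\<mu>\<^sup>-\<^sup>1\<^sup>/\<^sup>2\<close>, so for large \<open>\<mu>\<close> the bound forces \<open>w = 0\<close>.

  Exponents \<open>\<alpha> l \<le> -1\<close> are harmless: all terms on the left of the equation are integrable near \<open>0\<close>,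
  so the existence of a solution forces the coefficients of each such power to add up to \<open>0\<close>
  (\<open>power_sum_integrable_near_0\<close>), and then the corresponding terms of the formula cancel as well.

  The formulas for the roots are Ferrari's, with the resolvent cubic solved by Cardano's formula.
  They need \<open>R \<noteq> 0\<close>; this can only fail for \<open>\<beta> = 0\<close>, and there it is excluded because a principal
  cube root has positive real part (\<open>bt_R_nonzero\<close>).
\<close>

section \<open>Ferrari's formula for the roots\<close>

text \<open>
  The principal argument lies in \<open>(-\<pi>, \<pi>]\<close>, so a third of it lies strictly inside \<open>(-\<pi>/2, \<pi>/2)\<close>.
\<close>

lemma Re_cube_root_pos: "z \<noteq> 0 \<Longrightarrow> Re (z powr (1/3)) > 0"
proof -
  assume z: "z \<noteq> 0"
  have "\<bar>Im (Ln z) / 3\<bar> < pi/2"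
    using mpi_less_Im_Ln[OF z] Im_Ln_le_pi[OF z] pi_gt_zero by (auto simp: abs_if)
  then have "cos (Im (Ln z) / 3) > 0" by (intro cos_gt_zero_pi) auto
  then show ?thesis using z by (simp add: powr_def Re_exp)
qed

lemma cube_root_cubed: "(z powr (1/3)) ^ 3 = (z::complex)"
  by (cases "z = 0") (auto simp: powr_def simp flip: exp_of_nat_mult)

text \<open>
  A positive real factor leaves the argument unchanged and may be pulled out of a principal cube root.  This
  relates the cube roots of the different multiples of \<open>\<delta>\<close> in the formulas to each other.
\<close>

lemma cube_root_scale:
  assumes "x > 0" "z \<noteq> 0"
  shows "(of_real x * z) powr (1/3) = of_real (root 3 x) * z powr (1/3 :: complex)"
proof -
  have "Ln (of_real x * z) = of_real (ln x) + Ln z" using Ln_times_of_real[OF assms] Ln_of_real[OF assms(1)] by simp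
  moreover have "exp (of_real (ln x) / 3) = complex_of_real (root 3 x)"
    using assms by (simp add: root_powr_inverse powr_def flip: exp_of_real)
  ultimately show ?thesis using assms by (simp add: powr_def exp_add add_divide_distrib)
qed

lemma bt_delta_quadratic: "(bt_delta \<beta> \<gamma>)\<^sup>2 - 18 * \<beta>\<^sup>2 * \<gamma> * bt_delta \<beta> \<gamma> + 768 * \<gamma>^3 = 0"
proof -
  define q where "q = csqrt (81 * \<beta>^4 - 768 * \<gamma>)"
  have "q\<^sup>2 = 81 * \<beta>^4 - 768 * \<gamma>" unfolding q_def by simp
  then show ?thesis unfolding bt_delta_def q_def[symmetric] by algebra
qed

lemma bt_delta_nonzero: "\<gamma> \<noteq> 0 \<Longrightarrow> bt_delta \<beta> \<gamma> \<noteq> 0"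
  using bt_delta_quadratic[of \<beta> \<gamma>] by auto

text \<open>
  The number \<open>X + Z\<close> under the root in \<open>R\<close> is Cardano's solution of the cubic
  \<open>S\<^sup>3 = 4 \<gamma> S + \<beta>\<^sup>2 \<gamma>\<close>, the resolvent of the quartic: \<open>X\<^sup>3\<close> and \<open>Z\<^sup>3\<close> are the two roots of a
  quadratic with sum \<open>\<beta>\<^sup>2 \<gamma>\<close> by the choice of \<open>\<delta>\<close>, and the branches fit since \<open>X Z = 4 \<gamma> / 3\<close>.
  The last equation says that the term appearing in \<open>T\<close> is the same \<open>Z\<close>.
\<close>

lemma cardano_resolvent:
  fixes \<beta> \<gamma> :: complex
  assumes "\<gamma> \<noteq> 0"
  defines "X \<equiv> cbrt (bt_delta \<beta> \<gamma> / 18)" and "Z \<equiv> 8 * \<gamma> / cbrt (12 * bt_delta \<beta> \<gamma>)"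
  shows "X * Z = 4 * \<gamma> / 3" "(X + Z)^3 = \<beta>\<^sup>2 * \<gamma> + 4 * \<gamma> * (X + Z)"
    "4 * \<gamma> * (cbrt 2 / cbrt (3 * bt_delta \<beta> \<gamma>)) = Z"
proof -
  define \<delta> where "\<delta> = bt_delta \<beta> \<gamma>"
  have \<delta>: "\<delta> \<noteq> 0" using bt_delta_nonzero assms by (simp add: \<delta>_def)
  have 12: "cbrt (12 * \<delta>) = 6 * X"
  proof -
    have "12 * \<delta> = of_real 216 * (\<delta> / 18)" by simp
    then have "cbrt (12 * \<delta>) = of_real (root 3 216) * X"
      unfolding X_def \<delta>_def[symmetric] using cube_root_scale[of 216 "\<delta>/18"] \<delta> by simp
    moreover have "root 3 216 = (6::real)" by (rule real_root_pos_unique) auto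
    ultimately show ?thesis by simp
  qed
  have X0: "X \<noteq> 0" using \<delta> by (simp add: X_def \<delta>_def)
  show XZ: "X * Z = 4 * \<gamma> / 3" using X0 unfolding Z_def \<delta>_def[symmetric] 12 by (simp add: field_simps)
  have X3: "X^3 = \<delta> / 18" unfolding X_def \<delta>_def by (rule cube_root_cubed)
  have "X^3 * (X^3 + Z^3) = (X^3)\<^sup>2 + (X * Z)^3" by algebra
  also have "\<dots> = (\<delta>\<^sup>2 + 768 * \<gamma>^3) / 324"
    unfolding X3 XZ by (simp add: power2_eq_square power3_eq_cube field_simps)
  also have "\<dots> = X^3 * (\<beta>\<^sup>2 * \<gamma>)"
    using bt_delta_quadratic[of \<beta> \<gamma>] unfolding X3 \<delta>_def[symmetric] by (simp add: field_simps; algebra)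
  finally have "X^3 + Z^3 = \<beta>\<^sup>2 * \<gamma>" using X0 by simp
  moreover have "(X + Z)^3 = X^3 + Z^3 + 3 * (X * Z) * (X + Z)" by algebra
  ultimately show "(X + Z)^3 = \<beta>\<^sup>2 * \<gamma> + 4 * \<gamma> * (X + Z)" unfolding XZ by simp
  have "cbrt (12 * \<delta>) = of_real (root 3 4) * cbrt (3 * \<delta>)"
    using cube_root_scale[of 4 "3 * \<delta>"] \<delta> by simp
  moreover have "cbrt 2 = of_real (root 3 2)" using cube_root_scale[of 2 1] by simp
  moreover have "root 3 2 * root 3 4 = (2::real)"
  proof -
    have "root 3 2 * root 3 4 = root 3 (8::real)" by (simp flip: real_root_mult)
    also have "root 3 8 = (2::real)" by (rule real_root_pos_unique) auto
    finally show ?thesis .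
  qed
  then have "complex_of_real (root 3 2) * of_real (root 3 4) = 2" by (metis of_real_mult of_real_numeral)
  moreover have "complex_of_real (root 3 4) \<noteq> 0" by simp
  ultimately show "4 * \<gamma> * (cbrt 2 / cbrt (3 * bt_delta \<beta> \<gamma>)) = Z"
    unfolding Z_def \<delta>_def[symmetric] using \<delta> by (simp add: field_simps)
qed

text \<open>
  If \<open>R = 0\<close>, the resolvent cubic at \<open>S = -\<beta>\<^sup>2/4\<close> forces \<open>\<beta> = 0\<close>, and then \<open>Z = -X\<close> and
  \<open>X\<^sup>2 = -4 \<gamma> / 3\<close> is real.  As \<open>Re X > 0\<close>, \<open>X\<close> is a positive number, so \<open>\<gamma> < 0\<close> and
  \<open>\<delta> = 18 X\<^sup>3 > 0\<close>; but for \<open>\<beta> = 0\<close> and \<open>\<gamma> < 0\<close> the definition gives \<open>\<delta> < 0\<close>.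
\<close>

lemma bt_R_nonzero:
  fixes \<beta> \<gamma> :: real
  assumes "\<gamma> \<noteq> 0"
  shows "bt_R (of_real \<beta>) (of_real \<gamma>) \<noteq> 0"
proof
  define \<delta> where "\<delta> = bt_delta (of_real \<beta>) (of_real \<gamma>)"
  define X where "X = cbrt (\<delta> / 18)"
  define Z where "Z = 8 * of_real \<gamma> / cbrt (12 * \<delta>)"
  note res = cardano_resolvent[of "of_real \<gamma>" "of_real \<beta>", folded \<delta>_def, folded X_def Z_def]
  assume "bt_R (of_real \<beta>) (of_real \<gamma>) = 0"
  then have S: "X + Z = - ((of_real \<beta> / 2)\<^sup>2)"
    unfolding bt_R_def Let_def \<delta>_def[symmetric] X_def[symmetric] Z_def[symmetric]
    by (simp add: algebra_simps eq_neg_iff_add_eq_0)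
  have "(of_real \<beta> :: complex)^6 = 0"
    using res(2) assms unfolding S by (simp add: field_simps) 
  then have \<beta>: "\<beta> = 0" by simp
  with S have "Z = - X" by (simp add: eq_neg_iff_add_eq_0 add.commute)
  then have "X * X = - (X * Z)" by simp
  then have X2: "X * X = of_real (- 4 * \<gamma> / 3)" using res(1) assms by simp
  have \<delta>0: "\<delta> \<noteq> 0" using bt_delta_nonzero[of "of_real \<gamma>"] assms by (simp add: \<delta>_def)
  have ReX: "Re X > 0" unfolding X_def using \<delta>0 by (intro Re_cube_root_pos) auto
  have "Re X * Im X + Im X * Re X = 0" using arg_cong[OF X2, of Im] by auto
  then have ImX: "Im X = 0" using ReX by simp
  have "Re X * Re X = - 4 * \<gamma> / 3" using arg_cong[OF X2, of Re] ImX by simp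
  then have \<gamma>: "\<gamma> < 0" using mult_pos_pos[OF ReX ReX] by simp
  have "X = of_real (Re X)" using ImX by (simp add: complex_eq_iff)
  then have "\<delta> / 18 = of_real (Re X ^ 3)"
    using cube_root_cubed[of "\<delta> / 18"] unfolding X_def[symmetric] by (metis of_real_power)
  then have "Re \<delta> > 0" using ReX by (simp add: complex_eq_iff)
  moreover have "\<delta> = of_real (sqrt (- 768 * \<gamma>) * \<gamma>)"
    using \<gamma> csqrt_of_real[of "- 768 * \<gamma>"] unfolding \<delta>_def bt_delta_def \<beta> by simp
  ultimately show False using \<gamma> by (simp add: zero_less_mult_iff)
qed

text \<open>
  Ferrari: with \<open>w = x + \<beta>/4\<close> the monic quartic is the product of \<open>(w - R)\<^sup>2 - T\<^sub>+\<^sup>2\<close> and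
  \<open>(w + R)\<^sup>2 - T\<^sub>-\<^sup>2\<close>.  Comparing coefficients in \<open>w\<close>, the only condition left is the resolvent
  cubic for \<open>S = 4 R\<^sup>2 - \<beta>\<^sup>2/4\<close>.
\<close>

lemma bt_poly_factorisation:
  assumes "a \<noteq> 0" "c \<noteq> 0"
  shows "poly (bt_poly a b c) x = of_real a * (\<Prod>k=1..4. x - bt_root a b c k)"
proof -
  define \<beta> \<gamma> where "\<beta> = complex_of_real (b / a)" and "\<gamma> = complex_of_real (c / a)"
  define \<delta> where "\<delta> = bt_delta \<beta> \<gamma>"
  define S where "S = cbrt (\<delta> / 18) + 8 * \<gamma> / cbrt (12 * \<delta>)"
  define R where "R = bt_R \<beta> \<gamma>"
  define T U where "T = bt_T 1 \<beta> \<gamma>" and "U = bt_T (-1) \<beta> \<gamma>"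
  have \<gamma>: "\<gamma> \<noteq> 0" using assms by (simp add: \<gamma>_def)
  have R0: "R \<noteq> 0" unfolding R_def \<beta>_def \<gamma>_def using assms by (intro bt_R_nonzero) simp
  note res = cardano_resolvent[OF \<gamma>, of \<beta>, folded \<delta>_def]
  have "4 * R\<^sup>2 = \<beta>\<^sup>2 / 4 + S"
    unfolding R_def bt_R_def Let_def \<delta>_def[symmetric] S_def by (simp add: power_mult_distrib power_divide)
  then have S: "S = 4 * R\<^sup>2 - \<beta>\<^sup>2 / 4" by simp
  define q where "q = \<beta>^3 / (8 * R)"
  have q: "8 * R * q = \<beta>^3" using R0 by (simp add: q_def)
  have T: "4 * T\<^sup>2 = \<beta>\<^sup>2 / 2 - S - q" and U: "4 * U\<^sup>2 = \<beta>\<^sup>2 / 2 - S + q"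
    unfolding T_def U_def bt_T_def Let_def \<delta>_def[symmetric] R_def[symmetric] S_def q_def
    by (simp_all add: power_mult_distrib power_divide flip: res(3))
  have "S^3 = \<beta>\<^sup>2 * \<gamma> + 4 * \<gamma> * S" using res(2) by (simp add: S_def)
  then have \<gamma>_eq: "16 * R\<^sup>2 * \<gamma> = (4 * R\<^sup>2 - \<beta>\<^sup>2 / 4)^3" unfolding S by (simp add: algebra_simps)
  define w where "w = x + \<beta> / 4"
  \<comment> \<open>This scaling of \<open>\<beta>\<close> and \<open>q\<close> clears all denominators.\<close>
  define B p where "B = \<beta> / 4" and "p = q / 4"
  have Bp: "\<beta> = 4 * B" "q = 4 * p" by (simp_all add: B_def p_def)
  have T': "T\<^sup>2 = 3 * B\<^sup>2 - R\<^sup>2 - p" and U': "U\<^sup>2 = 3 * B\<^sup>2 - R\<^sup>2 + p"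
  proof -
    have "4 * T\<^sup>2 = 4 * (3 * B\<^sup>2 - R\<^sup>2 - p)" "4 * U\<^sup>2 = 4 * (3 * B\<^sup>2 - R\<^sup>2 + p)"
      using T U unfolding S Bp by (simp_all add: power_mult_distrib)
    then show "T\<^sup>2 = 3 * B\<^sup>2 - R\<^sup>2 - p" "U\<^sup>2 = 3 * B\<^sup>2 - R\<^sup>2 + p"
      by (metis mult_left_cancel zero_neq_numeral)+
  qed
  have "4 * R\<^sup>2 - \<beta>\<^sup>2 / 4 = 4 * (R\<^sup>2 - B\<^sup>2)" unfolding Bp by (simp add: power_mult_distrib)
  then have "16 * (R\<^sup>2 * \<gamma>) = 16 * (4 * (R\<^sup>2 - B\<^sup>2)^3)"
    using \<gamma>_eq by (simp only: power_mult_distrib) (simp only: mult.assoc; simp)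
  then have g: "R\<^sup>2 * \<gamma> = 4 * (R\<^sup>2 - B\<^sup>2)^3" by (metis mult_left_cancel zero_neq_numeral)
  have p: "R * p = 2 * B^3" using q unfolding Bp by (simp add: power_mult_distrib)
  have "R\<^sup>2 * (((w - R)\<^sup>2 - T\<^sup>2) * ((w + R)\<^sup>2 - U\<^sup>2))
      = R\<^sup>2 * (w\<^sup>2 + 2 * R\<^sup>2 - 3 * B\<^sup>2)\<^sup>2 - (2 * R\<^sup>2 * w - R * p)\<^sup>2"
    unfolding T' U' by (simp add: power2_eq_square algebra_simps)
  also have "\<dots> = R\<^sup>2 * (x^4 + \<beta> * x^3) + R\<^sup>2 * \<gamma>"
    unfolding p g w_def Bp by (simp add: eval_nat_numeral algebra_simps)
  also have "\<dots> = R\<^sup>2 * (x^4 + \<beta> * x^3 + \<gamma>)" by (simp add: algebra_simps)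
  finally have "R\<^sup>2 * (((w - R)\<^sup>2 - T\<^sup>2) * ((w + R)\<^sup>2 - U\<^sup>2)) = R\<^sup>2 * (x^4 + \<beta> * x^3 + \<gamma>)" .
  then have eq: "((w - R)\<^sup>2 - T\<^sup>2) * ((w + R)\<^sup>2 - U\<^sup>2) = x^4 + \<beta> * x^3 + \<gamma>" using R0 by simp
  have roots: "bt_root a b c 1 = - \<beta> / 4 + R + T" "bt_root a b c 2 = - \<beta> / 4 - R + U"
    "bt_root a b c 3 = - \<beta> / 4 + R - T" "bt_root a b c 4 = - \<beta> / 4 - R - U"
    unfolding bt_root_def Let_def \<beta>_def[symmetric] \<gamma>_def[symmetric] R_def[symmetric] T_def[symmetric] U_def[symmetric]
    by simp_all
  have four: "{1..4} = {1, 2, 3, 4::nat}" by auto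
  have "(\<Prod>k=1..4. x - bt_root a b c k)
      = (x - bt_root a b c 1) * (x - bt_root a b c 2) * (x - bt_root a b c 3) * (x - bt_root a b c 4)"
    unfolding four by (simp add: mult.assoc)
  also have "\<dots> = ((w - R) - T) * ((w + R) - U) * ((w - R) + T) * ((w + R) + U)"
    unfolding roots w_def by (intro arg_cong2[of _ _ _ _ "(*)"]) simp_all
  also have "\<dots> = ((w - R)\<^sup>2 - T\<^sup>2) * ((w + R)\<^sup>2 - U\<^sup>2)"
  proof -
    have "(u - T) * (v - U) * (u + T) * (v + U) = (u\<^sup>2 - T\<^sup>2) * (v\<^sup>2 - U\<^sup>2)" for u v
      by (simp add: power2_eq_square algebra_simps)
    then show ?thesis .
  qed
  finally have prod: "(\<Prod>k=1..4. x - bt_root a b c k) = x^4 + \<beta> * x^3 + \<gamma>" unfolding eq .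
  have "of_real a * (x^4 + \<beta> * x^3 + \<gamma>) = poly (bt_poly a b c) x"
    using assms by (simp add: bt_poly_def poly_monom \<beta>_def \<gamma>_def algebra_simps)
  then show ?thesis unfolding prod ..
qed

text \<open>
  For \<open>a = 0\<close> the degree is too small; for \<open>c = 0\<close> the root \<open>0\<close> is triple.
\<close>

lemma bt_poly_4_roots_nonzero:
  assumes "card {r. poly (bt_poly a b c) r = 0} = 4"
  shows "a \<noteq> 0" "c \<noteq> 0"
proof -
  show "a \<noteq> 0"
  proof
    assume "a = 0"
    then have "degree (bt_poly a b c) \<le> 3"
      using degree_add_le[OF degree_monom_le[of "complex_of_real b" 3], of "monom (of_real c) 0"]
      by (simp add: bt_poly_def degree_monom_eq monom_0)
    moreover have "bt_poly a b c \<noteq> 0" using assms infinite_UNIV_char_0[where 'a=complex] by auto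
    ultimately show False using card_poly_roots_bound[of "bt_poly a b c"] assms by linarith
  qed
  show "c \<noteq> 0"
  proof
    assume "c = 0"
    then have "r = 0 \<or> r = - of_real b / of_real a" if "poly (bt_poly a b c) r = 0" for r
    proof -
      have "r^3 * (of_real a * r + of_real b) = 0"
        using that \<open>c = 0\<close> by (simp add: bt_poly_def poly_monom power_numeral_reduce algebra_simps)
      then consider "r = 0" | "of_real a * r + of_real b = 0" by auto
      then show ?thesis
      proof cases
        case 2
        then have "of_real a * r = - of_real b" by (simp add: eq_neg_iff_add_eq_0)
        then show ?thesis using \<open>a \<noteq> 0\<close> by (auto simp: field_simps)
      qed simp
    qed
    then have "{r. poly (bt_poly a b c) r = 0} \<subseteq> {0, - of_real b / of_real a}" by auto
    then have "card {r. poly (bt_poly a b c) r = 0} \<le> card {0, - complex_of_real b / of_real a}"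
      by (intro card_mono) auto
    also have "\<dots> \<le> 2" by (simp add: card_insert_if)
    finally show False using assms by simp
  qed
qed

lemma bt_root_bij:
  assumes "card {r. poly (bt_poly a b c) r = 0} = 4"
  shows "bij_betw (bt_root a b c) {1..4} {r. poly (bt_poly a b c) r = 0}"
proof -
  have "{r. poly (bt_poly a b c) r = 0} = bt_root a b c ` {1..4}"
    using bt_poly_factorisation[OF bt_poly_4_roots_nonzero[OF assms]]
      bt_poly_4_roots_nonzero[OF assms] by auto
  then show ?thesis using assms by (simp add: bij_betw_def eq_card_imp_inj_on)
qed

section \<open>Power moments of the roots\<close>

text \<open>
  The denominators are \<open>P'(r\<^sub>k)\<close>, so this is the coefficient of \<open>x\<close> to the power \<open>-j-1\<close> in the expansion
  of \<open>1 / P(x)\<close> at infinity.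
\<close>

definition bt_moment :: "real \<Rightarrow> real \<Rightarrow> real \<Rightarrow> nat \<Rightarrow> complex" where
  "bt_moment a b c j = (\<Sum>k=1..4. bt_root a b c k ^ j /
      (4 * of_real a * bt_root a b c k ^ 3 + 3 * of_real b * bt_root a b c k ^ 2))"

text \<open>
  These are the coefficients of \<open>1 / ((X-x)(X-y)(X-z)(X-w))\<close> at infinity.  Multiplying by the
  Vandermonde product \<open>D\<close> turns each of them into a polynomial identity.
\<close>

lemma lagrange_moments_4:
  fixes x y z w :: "'a::field"
  assumes "x \<noteq> y" "x \<noteq> z" "x \<noteq> w" "y \<noteq> z" "y \<noteq> w" "z \<noteq> w"
  defines "L \<equiv> \<lambda>j. x^j / ((x-y)*(x-z)*(x-w)) + y^j / ((y-x)*(y-z)*(y-w))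
                + z^j / ((z-x)*(z-y)*(z-w)) + w^j / ((w-x)*(w-y)*(w-z))"
  shows "L 0 = 0" "L 1 = 0" "L 2 = 0" "L 3 = 1"
proof -
  define D where "D = (x-y)*(x-z)*(x-w)*(y-z)*(y-w)*(z-w)"
  have D: "D \<noteq> 0" using assms(1-6) by (simp add: D_def)
  have L: "D * L j = x^j*((y-z)*(y-w)*(z-w)) - y^j*((x-z)*(x-w)*(z-w))
       + z^j*((x-y)*(x-w)*(y-w)) - w^j*((x-y)*(x-z)*(y-z))" for j
  proof -
    have cancel: "D * (n / X) = n * V" if "D = X * V" "X \<noteq> 0" for n X V
      using that by simp
    \<comment> \<open>Each denominator divides \<open>D\<close>; the sign counts the factors that occur reversed.\<close>
    have D4: "D = ((x-y)*(x-z)*(x-w)) * ((y-z)*(y-w)*(z-w))"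
         "D = ((y-x)*(y-z)*(y-w)) * (- ((x-z)*(x-w)*(z-w)))"
         "D = ((z-x)*(z-y)*(z-w)) * ((x-y)*(x-w)*(y-w))"
         "D = ((w-x)*(w-y)*(w-z)) * (- ((x-y)*(x-z)*(y-z)))"
      unfolding D_def by algebra+
    have "D * (x^j / ((x-y)*(x-z)*(x-w))) = x^j * ((y-z)*(y-w)*(z-w))"
         "D * (y^j / ((y-x)*(y-z)*(y-w))) = y^j * (- ((x-z)*(x-w)*(z-w)))"
         "D * (z^j / ((z-x)*(z-y)*(z-w))) = z^j * ((x-y)*(x-w)*(y-w))"
         "D * (w^j / ((w-x)*(w-y)*(w-z))) = w^j * (- ((x-y)*(x-z)*(y-z)))"
      by (rule cancel[OF D4(1)] cancel[OF D4(2)] cancel[OF D4(3)] cancel[OF D4(4)]; use assms(1-6) in simp)+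
    then show ?thesis unfolding L_def by (simp add: distrib_left)
  qed
  have "D * L 0 = 0" "D * L 1 = 0" "D * L 2 = 0" "D * L 3 = D * 1"
    unfolding L by (simp_all add: D_def; algebra)+
  then show "L 0 = 0" "L 1 = 0" "L 2 = 0" "L 3 = 1" using D by simp_all
qed

text \<open>
  The initial values come from comparing \<open>P'\<close> with the derivative of the factored form; the recursion
  is \<open>P(r\<^sub>k) = 0\<close> multiplied by \<open>r\<^sub>k\<^sup>j / P'(r\<^sub>k)\<close> and summed over \<open>k\<close>.
\<close>

lemma bt_moment_rec:
  assumes card: "card {r. poly (bt_poly a b c) r = 0} = 4"
  shows "bt_moment a b c 0 = 0" "bt_moment a b c 1 = 0" "bt_moment a b c 2 = 0"
    "of_real a * bt_moment a b c 3 = 1"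
    "of_real a * bt_moment a b c (j + 4) + of_real b * bt_moment a b c (j + 3) + of_real c * bt_moment a b c j = 0"
proof -
  define r where "r = bt_root a b c"
  note a = bt_poly_4_roots_nonzero(1)[OF card]
  note bij = bt_root_bij[OF card, folded r_def]
  have four: "{1..4} = {1, 2, 3, 4::nat}" by auto
  have inj: "r i \<noteq> r j" if "i \<in> {1..4}" "j \<in> {1..4}" "i \<noteq> j" for i j
    using bij that by (auto simp: bij_betw_def inj_on_def)
  have ne: "r 1 \<noteq> r 2" "r 1 \<noteq> r 3" "r 1 \<noteq> r 4" "r 2 \<noteq> r 3" "r 2 \<noteq> r 4" "r 3 \<noteq> r 4"
    by (rule inj; simp)+
  have root: "of_real a * r k ^ 4 + of_real b * r k ^ 3 + of_real c = 0" if "k \<in> {1..4}" for k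
  proof -
    have "poly (bt_poly a b c) (r k) = 0" using bij that by (auto simp: bij_betw_def)
    then show ?thesis by (simp add: bt_poly_def poly_monom)
  qed
  have fac: "poly (bt_poly a b c) = (\<lambda>x. of_real a * ((x - r 1) * (x - r 2) * (x - r 3) * (x - r 4)))"
    using bt_poly_factorisation[OF bt_poly_4_roots_nonzero[OF card], of b]
    unfolding four
    by (intro ext) (simp add: r_def mult.assoc)
  have der: "(poly (bt_poly a b c) has_field_derivative 4 * of_real a * x^3 + 3 * of_real b * x^2) (at x)" for x
    unfolding bt_poly_def poly_add poly_monom by (auto intro!: derivative_eq_intros)
  have der': "(poly (bt_poly a b c) has_field_derivative of_real a *
      ((x - r 2) * (x - r 3) * (x - r 4) + (x - r 1) * (x - r 3) * (x - r 4)
      + (x - r 1) * (x - r 2) * (x - r 4) + (x - r 1) * (x - r 2) * (x - r 3))) (at x)" for x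
    unfolding fac
    by (auto intro!: derivative_eq_intros simp: algebra_simps)
  note D = DERIV_unique[OF der der']
  define L where "L j = r 1^j / ((r 1-r 2)*(r 1-r 3)*(r 1-r 4)) + r 2^j / ((r 2-r 1)*(r 2-r 3)*(r 2-r 4))
                + r 3^j / ((r 3-r 1)*(r 3-r 2)*(r 3-r 4)) + r 4^j / ((r 4-r 1)*(r 4-r 2)*(r 4-r 3))" for j
  have L: "of_real a * bt_moment a b c j = L j" for j
  proof -
    have "4 * of_real a * r 1^3 + 3 * of_real b * r 1^2 = of_real a * ((r 1-r 2)*(r 1-r 3)*(r 1-r 4))"
         "4 * of_real a * r 2^3 + 3 * of_real b * r 2^2 = of_real a * ((r 2-r 1)*(r 2-r 3)*(r 2-r 4))"
         "4 * of_real a * r 3^3 + 3 * of_real b * r 3^2 = of_real a * ((r 3-r 1)*(r 3-r 2)*(r 3-r 4))"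
         "4 * of_real a * r 4^3 + 3 * of_real b * r 4^2 = of_real a * ((r 4-r 1)*(r 4-r 2)*(r 4-r 3))"
      using D[of "r 1"] D[of "r 2"] D[of "r 3"] D[of "r 4"] by simp_all
    then have "bt_moment a b c j = L j / of_real a"
      unfolding bt_moment_def r_def[symmetric] four L_def by (simp add: add_divide_distrib mult.commute)
    then show ?thesis using a by simp
  qed
  have lag: "L 0 = 0" "L 1 = 0" "L 2 = 0" "L 3 = 1"
    unfolding L_def by (rule lagrange_moments_4[OF ne])+
  show "bt_moment a b c 0 = 0" "bt_moment a b c 1 = 0" "bt_moment a b c 2 = 0"
    "of_real a * bt_moment a b c 3 = 1"
    using L[of 0] L[of 1] L[of 2] L[of 3] lag a by simp_all
  have "of_real a * bt_moment a b c (j + 4) + of_real b * bt_moment a b c (j + 3) + of_real c * bt_moment a b c j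
     = (\<Sum>k=1..4. (of_real a * r k ^ 4 + of_real b * r k ^ 3 + of_real c) * r k ^ j /
        (4 * of_real a * r k ^ 3 + 3 * of_real b * r k ^ 2))"
  proof -
    have "A * (x ^ (j + 4) / d) + B * (x ^ (j + 3) / d) + C * (x ^ j / d)
        = (A * x ^ 4 + B * x ^ 3 + C) * x ^ j / d" for A B C x d :: complex
      unfolding times_divide_eq_right add_divide_distrib[symmetric] power_add
      by (rule arg_cong2[of _ _ _ _ "(/)"]) (simp_all add: algebra_simps)
    then show ?thesis
      unfolding bt_moment_def r_def[symmetric] sum_distrib_left sum.distrib[symmetric] by simp
  qed
  also have "\<dots> = 0" using root by simp
  finally show "of_real a * bt_moment a b c (j + 4) + of_real b * bt_moment a b c (j + 3) + of_real c * bt_moment a b c j = 0" .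
qed

section \<open>Fractional power series\<close>

text \<open>
  The growth condition under which fractional power series converge for all \<open>t > 0\<close>: reciprocal
  gamma values decay faster than any geometric sequence.
\<close>

definition geom_bounded :: "(nat \<Rightarrow> real) \<Rightarrow> bool" where
  "geom_bounded h \<longleftrightarrow> (\<exists>K\<ge>0. \<exists>\<rho>\<ge>0. \<forall>j. \<bar>h j\<bar> \<le> K * \<rho> ^ j)"

text \<open>
  This is \<open>\<Sum>j. h j J\<^sup>j\<close> applied to \<open>t\<^sup>\<beta> / \<Gamma>(\<beta> + 1)\<close>, where \<open>J\<close> is half integration.  The reciprocal
  gamma function is entire, so that differentiation lowers \<open>\<beta>\<close> by \<open>1\<close> for every real \<open>\<beta>\<close>.
\<close>

definition frac_series :: "(nat \<Rightarrow> real) \<Rightarrow> real \<Rightarrow> real \<Rightarrow> real" where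
  "frac_series h \<beta> t = (\<Sum>j. h j * rGamma (\<beta> + 1 + real j / 2) * t powr (\<beta> + real j / 2))"

text \<open>
  Ratio test: \<open>rGamma (\<beta> + j) = (\<beta> + j) rGamma (\<beta> + j + 1)\<close>, so consecutive ratios tend to \<open>0\<close>.
\<close>

lemma summable_rGamma_power:
  fixes x \<beta> :: real
  assumes "x \<ge> 0"
  shows "summable (\<lambda>j. x ^ j * \<bar>rGamma (\<beta> + real j)\<bar>)"
proof (rule summable_ratio_test[of "1/2" "nat \<lceil>2 * x - \<beta>\<rceil>"])
  fix n assume "nat \<lceil>2 * x - \<beta>\<rceil> \<le> n"
  then have n: "2 * x \<le> \<beta> + real n" by linarith
  have "\<bar>rGamma (\<beta> + real n)\<bar> = (\<beta> + real n) * \<bar>rGamma (\<beta> + real (Suc n))\<bar>"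
  proof -
    have "rGamma (\<beta> + real n) = (\<beta> + real n) * rGamma (\<beta> + real (Suc n))"
      using rGamma_plus1[of "\<beta> + real n"] by (simp add: add_ac)
    then show ?thesis using n assms by (simp add: abs_mult)
  qed
  then have "x * \<bar>rGamma (\<beta> + real (Suc n))\<bar> \<le> 1/2 * \<bar>rGamma (\<beta> + real n)\<bar>"
    using mult_right_mono[OF n, of "\<bar>rGamma (\<beta> + real (Suc n))\<bar>"] by simp
  from mult_left_mono[OF this, of "x ^ n"]
  show "norm (x ^ Suc n * \<bar>rGamma (\<beta> + real (Suc n))\<bar>) \<le> 1/2 * norm (x ^ n * \<bar>rGamma (\<beta> + real n)\<bar>)"
    using assms by (simp add: abs_mult mult_ac)
qed simp

text \<open>
  The functional equation of the gamma function steps by \<open>1\<close>, hence even and odd indices are treated as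
  two separate series.
\<close>

lemma summable_rGamma_half_power:
  fixes x \<beta> :: real
  assumes "x \<ge> 0"
  shows "summable (\<lambda>j. x ^ j * \<bar>rGamma (\<beta> + real j / 2)\<bar>)"
proof -
  define f g where "f i = (x\<^sup>2) ^ i * \<bar>rGamma (\<beta> + real i)\<bar>"
    and "g i = x * ((x\<^sup>2) ^ i * \<bar>rGamma (\<beta> + 1/2 + real i)\<bar>)" for i
  have "summable f" "summable g"
    unfolding f_def g_def by (intro summable_mult summable_rGamma_power; simp)+
  from sums_if[OF this(2)[THEN summable_sums] this(1)[THEN summable_sums]]
  have "summable (\<lambda>n. if even n then f (n div 2) else g ((n - 1) div 2))" by (rule sums_summable)
  moreover have "(\<lambda>n. if even n then f (n div 2) else g ((n - 1) div 2)) =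
      (\<lambda>j. x ^ j * \<bar>rGamma (\<beta> + real j / 2)\<bar>)"
    by (auto simp: f_def g_def fun_eq_iff power_mult add_divide_distrib add_ac elim!: evenE oddE)
  ultimately show ?thesis by simp
qed

lemma geom_bounded_summable:
  assumes "geom_bounded h" "x \<ge> 0"
  shows "summable (\<lambda>j. \<bar>h j\<bar> * x ^ j * \<bar>rGamma (\<beta> + real j / 2)\<bar>)"
proof -
  from assms obtain K \<rho> where K: "K \<ge> 0" "\<rho> \<ge> 0" "\<And>j. \<bar>h j\<bar> \<le> K * \<rho> ^ j"
    unfolding geom_bounded_def by auto
  show ?thesis
  proof (rule summable_comparison_test'[where N = 0])
    show "summable (\<lambda>j. K * ((\<rho> * x) ^ j * \<bar>rGamma (\<beta> + real j / 2)\<bar>))"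
      using assms K by (intro summable_mult summable_rGamma_half_power) simp
  next
    fix j
    have "\<bar>h j\<bar> * (x ^ j * \<bar>rGamma (\<beta> + real j / 2)\<bar>) \<le> K * \<rho> ^ j * (x ^ j * \<bar>rGamma (\<beta> + real j / 2)\<bar>)"
      using assms K by (intro mult_right_mono) auto
    then show "norm (\<bar>h j\<bar> * x ^ j * \<bar>rGamma (\<beta> + real j / 2)\<bar>) \<le> K * ((\<rho> * x) ^ j * \<bar>rGamma (\<beta> + real j / 2)\<bar>)"
      using assms by (simp add: power_mult_distrib mult_ac)
  qed
qed

lemma powr_half_nat: "t > 0 \<Longrightarrow> t powr (\<beta> + real j / 2) = t powr \<beta> * sqrt t ^ j"
proof -
  assume t: "t > 0"
  have "t powr (real j / 2) = (t powr (1/2)) powr real j" by (simp only: powr_powr) simp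
  also have "\<dots> = sqrt t ^ j" using t by (simp add: powr_realpow powr_half_sqrt)
  finally show ?thesis by (simp only: powr_add)
qed

lemma frac_series_summable:
  assumes "geom_bounded h" "t > 0"
  shows "summable (\<lambda>j. \<bar>h j * rGamma (\<beta> + 1 + real j / 2) * t powr (\<beta> + real j / 2)\<bar>)"
    and "summable (\<lambda>j. h j * rGamma (\<beta> + 1 + real j / 2) * t powr (\<beta> + real j / 2))"
proof -
  have "summable (\<lambda>j. t powr \<beta> * (\<bar>h j\<bar> * sqrt t ^ j * \<bar>rGamma (\<beta> + 1 + real j / 2)\<bar>))"
    using assms by (intro summable_mult geom_bounded_summable) auto
  then show "summable (\<lambda>j. \<bar>h j * rGamma (\<beta> + 1 + real j / 2) * t powr (\<beta> + real j / 2)\<bar>)"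
    using assms(2) by (simp add: powr_half_nat abs_mult mult_ac)
  then show "summable (\<lambda>j. h j * rGamma (\<beta> + 1 + real j / 2) * t powr (\<beta> + real j / 2))"
    by (rule summable_rabs_cancel)
qed

text \<open>
  All the powers \<open>t\<^sup>j\<^sup>/\<^sup>2\<close> are at most \<open>1\<close>, so the leading power dominates near the origin.
\<close>

lemma frac_series_bound:
  assumes "geom_bounded h"
  obtains A where "\<And>t. 0 < t \<Longrightarrow> t \<le> 1 \<Longrightarrow> \<bar>frac_series h \<beta> t\<bar> \<le> A * t powr \<beta>"
proof
  fix t :: real assume t: "0 < t" "t \<le> 1"
  note summ = geom_bounded_summable[OF assms, of 1 "\<beta> + 1", simplified]
  have "\<bar>frac_series h \<beta> t\<bar> \<le> (\<Sum>j. \<bar>h j * rGamma (\<beta> + 1 + real j / 2) * t powr (\<beta> + real j / 2)\<bar>)"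
    unfolding frac_series_def by (intro summable_rabs frac_series_summable assms t)
  also have "\<dots> \<le> (\<Sum>j. (\<bar>h j\<bar> * \<bar>rGamma (\<beta> + 1 + real j / 2)\<bar>) * t powr \<beta>)"
  proof (intro suminf_le frac_series_summable assms t summable_mult2 summ)
    fix j
    have "sqrt t ^ j \<le> 1" using t by (intro power_le_one) auto
    then have "\<bar>h j\<bar> * \<bar>rGamma (\<beta> + 1 + real j / 2)\<bar> * t powr \<beta> * sqrt t ^ j \<le>
        \<bar>h j\<bar> * \<bar>rGamma (\<beta> + 1 + real j / 2)\<bar> * t powr \<beta> * 1"
      by (intro mult_left_mono) auto
    then show "\<bar>h j * rGamma (\<beta> + 1 + real j / 2) * t powr (\<beta> + real j / 2)\<bar>
        \<le> (\<bar>h j\<bar> * \<bar>rGamma (\<beta> + 1 + real j / 2)\<bar>) * t powr \<beta>"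
      using t by (simp add: powr_half_nat abs_mult mult_ac)
  qed
  also have "\<dots> = (\<Sum>j. \<bar>h j\<bar> * \<bar>rGamma (\<beta> + 1 + real j / 2)\<bar>) * t powr \<beta>"
    by (rule suminf_mult2[symmetric, OF summ])
  finally show "\<bar>frac_series h \<beta> t\<bar> \<le> (\<Sum>j. \<bar>h j\<bar> * \<bar>rGamma (\<beta> + 1 + real j / 2)\<bar>) * t powr \<beta>" .
qed

text \<open>
  Termwise: \<open>(\<beta> + j/2) rGamma (\<beta> + j/2 + 1) = rGamma (\<beta> + j/2)\<close>.  The differentiated series converges
  uniformly on \<open>[t/2, 2t]\<close> by the M-test.
\<close>

lemma frac_series_has_derivative:
  assumes "geom_bounded h" "t > 0"
  shows "(frac_series h \<beta> has_real_derivative frac_series h (\<beta> - 1) t) (at t)"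
proof -
  define f where "f j x = h j * rGamma (\<beta> + 1 + real j / 2) * x powr (\<beta> + real j / 2)" for j x
  define f' where "f' j x = h j * rGamma (\<beta> - 1 + 1 + real j / 2) * x powr (\<beta> - 1 + real j / 2)" for j x
  define S where "S = {t/2..2*t}"
  have der: "(f j has_field_derivative f' j x) (at x within S)" if "x \<in> S" for j x
  proof -
    have "x > 0" using that assms by (simp add: S_def)
    then have "(f j has_field_derivative h j * rGamma (\<beta> + 1 + real j / 2) *
       ((\<beta> + real j / 2) * x powr (\<beta> + real j / 2 - 1))) (at x within S)"
      unfolding f_def by (intro DERIV_cmult has_field_derivative_at_within[OF has_real_derivative_powr])
    also have "h j * rGamma (\<beta> + 1 + real j / 2) * ((\<beta> + real j / 2) * x powr (\<beta> + real j / 2 - 1)) = f' j x"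
    proof -
      have "rGamma (\<beta> - 1 + 1 + real j / 2) = (\<beta> + real j / 2) * rGamma (\<beta> + 1 + real j / 2)"
        using rGamma_plus1[of "\<beta> + real j / 2"] by (simp add: add_ac)
      moreover have "\<beta> - 1 + real j / 2 = \<beta> + real j / 2 - 1" by simp
      ultimately show ?thesis unfolding f'_def by (simp only: mult_ac)
    qed
    finally show ?thesis .
  qed
  define M where "M j = ((t/2) powr (\<beta> - 1) + (2*t) powr (\<beta> - 1)) *
    (\<bar>h j\<bar> * sqrt (2 * t) ^ j * \<bar>rGamma (\<beta> + real j / 2)\<bar>)" for j
  have "uniform_limit S (\<lambda>n x. \<Sum>i<n. f' i x) (\<lambda>x. \<Sum>i. f' i x) sequentially"
  proof (rule Weierstrass_m_test)
    show "summable M"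
      unfolding M_def using assms by (intro summable_mult geom_bounded_summable) auto
  next
    fix j x assume x: "x \<in> S"
    then have x0: "x > 0" using assms by (simp add: S_def)
    have "x powr (\<beta> - 1) \<le> (t/2) powr (\<beta> - 1) + (2*t) powr (\<beta> - 1)"
    proof (cases "\<beta> - 1 \<ge> 0")
      case True
      then have "x powr (\<beta> - 1) \<le> (2*t) powr (\<beta> - 1)" using x x0 by (intro powr_mono2) (auto simp: S_def)
      then show ?thesis by (simp add: add_increasing)
    next
      case False
      then have "x powr (\<beta> - 1) \<le> (t/2) powr (\<beta> - 1)"
        using x x0 assms by (intro powr_mono2') (auto simp: S_def)
      then show ?thesis by (simp add: add_increasing2)
    qed
    moreover have "sqrt x ^ j \<le> sqrt (2 * t) ^ j" using x x0 by (intro power_mono) (auto simp: S_def)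
    ultimately have "x powr (\<beta> - 1) * sqrt x ^ j \<le> ((t/2) powr (\<beta> - 1) + (2*t) powr (\<beta> - 1)) * sqrt (2 * t) ^ j"
      using x0 by (intro mult_mono) auto
    from mult_left_mono[OF this, of "\<bar>h j\<bar> * \<bar>rGamma (\<beta> + real j / 2)\<bar>"]
    show "norm (f' j x) \<le> M j" using x0 by (simp add: f'_def M_def powr_half_nat abs_mult mult_ac)
  qed
  then have "uniformly_convergent_on S (\<lambda>n x. \<Sum>i<n. f' i x)"
    by (auto simp: uniformly_convergent_on_def)
  from has_field_derivative_series'(2)[OF _ der this, of t t]
  have "((\<lambda>x. \<Sum>n. f n x) has_field_derivative (\<Sum>n. f' n t)) (at t)"
    using assms frac_series_summable(2)[OF assms, of \<beta>] by (auto simp: S_def f_def)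
  then show ?thesis by (simp add: frac_series_def[abs_def] f_def f'_def)
qed

text \<open>
  Substituting \<open>\<tau> = t x\<close> gives Euler's beta integral.
\<close>

lemma has_bochner_integral_power_half:
  assumes "\<beta> > -1" "t > (0::real)"
  shows "has_bochner_integral lborel
     (\<lambda>\<tau>. indicator {0<..<t} \<tau> *\<^sub>R (\<tau> powr \<beta> / (t - \<tau>) powr (1/2)))
     (Gamma (1/2) * Gamma (\<beta> + 1) * rGamma (\<beta> + 3/2) * t powr (\<beta> + 1/2))"
proof -
  have Beta: "has_bochner_integral lborel
     (\<lambda>x. indicator {0..1} x *\<^sub>R (x powr (\<beta> + 1 - 1) * (1 - x) powr (1/2 - 1 :: real))) (Beta (\<beta> + 1) (1/2))"
    using integrable_Beta[of "\<beta> + 1" "1/2"] set_borel_integral_eq_integral(2)[OF integrable_Beta[of "\<beta> + 1" "1/2"]]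
      integral_unique[OF has_integral_Beta_real[of "\<beta> + 1" "1/2"]] assms
    by (simp add: has_bochner_integral_iff set_integrable_def set_lebesgue_integral_def)
  define f where "f \<tau> = indicator {0<..<t} \<tau> *\<^sub>R (\<tau> powr \<beta> / (t - \<tau>) powr (1/2))" for \<tau>
  have "f (0 + t * x) = t powr (\<beta> - 1/2) * (indicator {0..1} x *\<^sub>R (x powr (\<beta> + 1 - 1) * (1 - x) powr (1/2 - 1)))" for x
  proof (cases "x \<in> {0<..<1}")
    case True
    have "t - t * x = t * (1 - x)" by (simp add: algebra_simps)
    then have 1: "(t - t * x) powr (1/2) = t powr (1/2) * (1 - x) powr (1/2)"
      using True assms by (simp add: powr_mult)
    have 2: "x powr (\<beta> + 1 - 1) * (1 - x) powr (1/2 - 1) = x powr \<beta> / (1 - x) powr (1/2)"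
      "t powr (\<beta> - 1/2) = t powr \<beta> / t powr (1/2)"
      using powr_minus_divide[of "1 - x" "1/2"] powr_diff[of t \<beta> "1/2"] by simp_all
    have "f (0 + t * x) = t powr \<beta> * x powr \<beta> / (t powr (1/2) * (1 - x) powr (1/2))"
      using True assms 1 by (simp add: f_def powr_mult)
    then show ?thesis using True
      unfolding 2 by simp
  next
    case False
    then have "x \<notin> {0..1} \<or> x = 0 \<or> x = 1" by auto
    then show ?thesis using assms False by (auto simp: f_def indicator_def mult_less_cancel_left1 zero_less_mult_iff)
  qed
  then have "has_bochner_integral lborel (\<lambda>x. f (0 + t * x)) (t powr (\<beta> - 1/2) * Beta (\<beta> + 1) (1/2))"
    using has_bochner_integral_mult_right[OF Beta, of "t powr (\<beta> - 1/2)"] by simp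
  moreover have "t powr (\<beta> - 1/2) * Beta (\<beta> + 1) (1/2) =
      (Gamma (1/2) * Gamma (\<beta> + 1) * rGamma (\<beta> + 3/2) * t powr (\<beta> + 1/2)) /\<^sub>R \<bar>t\<bar>"
  proof -
    have "t powr (\<beta> + 1/2) = t powr (\<beta> - 1/2) * t" using assms powr_add[of t "\<beta> - 1/2" 1] by (simp add: add.commute)
    moreover have "Beta (\<beta> + 1) (1/2) = Gamma (\<beta> + 1) * Gamma (1/2) * rGamma (\<beta> + 3/2)"
      unfolding Beta_altdef by (rule arg_cong2[of _ _ _ _ "(*)"]) (simp_all add: add.commute)
    ultimately show ?thesis using assms by simp
  qed
  ultimately show ?thesis
    using lborel_has_bochner_integral_real_affine_iff[of t f _ 0] assms unfolding f_def[symmetric] by simp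
qed

text \<open>
  Termwise integration; it is legitimate since the integrals of the absolute values are, up to the factor
  \<open>\<Gamma>(1/2)\<close>, the absolute values of the terms of the resulting series.
\<close>

lemma frac_series_half_integral:
  assumes h: "geom_bounded h" and \<beta>: "\<beta> > -1" and t: "t > 0"
  shows "set_integrable lborel {0<..<t} (\<lambda>\<tau>. frac_series h \<beta> \<tau> / (t - \<tau>) powr (1/2))"
    and "(LINT \<tau>:{0<..<t}|lborel. frac_series h \<beta> \<tau> / (t - \<tau>) powr (1/2)) = Gamma (1/2) * frac_series h (\<beta> + 1/2) t"
proof -
  define k where "k j = h j * rGamma (\<beta> + 1 + real j / 2)" for j
  define p where "p j \<tau> = indicator {0<..<t} \<tau> *\<^sub>R (\<tau> powr (\<beta> + real j / 2) / (t - \<tau>) powr (1/2))" for j \<tau>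
  define v where "v j = h j * rGamma (\<beta> + 1/2 + 1 + real j / 2) * t powr (\<beta> + 1/2 + real j / 2)" for j
  have bi: "has_bochner_integral lborel (\<lambda>\<tau>. k j * p j \<tau>) (Gamma (1/2) * v j)" for j
  proof -
    have "\<beta> + 1 + real j / 2 > 0" using \<beta> by simp
    then have "Gamma (\<beta> + real j / 2 + 1) * rGamma (\<beta> + 1 + real j / 2) = 1"
      by (simp add: rGamma_inverse_Gamma Gamma_eq_zero_iff add_ac nonpos_Ints_def)
    then have "Gamma (1/2) * v j = k j * (Gamma (1/2) * Gamma (\<beta> + real j / 2 + 1) * rGamma (\<beta> + real j / 2 + 3/2)
        * t powr (\<beta> + real j / 2 + 1/2))"
      by (simp add: v_def k_def algebra_simps)
    moreover have "has_bochner_integral lborel (\<lambda>\<tau>. k j * p j \<tau>) (k j * (Gamma (1/2) * Gamma (\<beta> + real j / 2 + 1)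
        * rGamma (\<beta> + real j / 2 + 3/2) * t powr (\<beta> + real j / 2 + 1/2)))"
      unfolding p_def using \<beta> t
      by (intro has_bochner_integral_mult_right has_bochner_integral_power_half) simp_all
    ultimately show ?thesis by (simp only:)
  qed
  have p0: "p j \<tau> \<ge> 0" for j \<tau> by (simp add: p_def)
  \<comment> \<open>Each summand has constant sign, so its absolute integral is the absolute value of its integral.\<close>
  have abs: "(LINT \<tau>|lborel. norm (k j * p j \<tau>)) = \<bar>Gamma (1/2) * v j\<bar>" for j
  proof -
    have "(LINT \<tau>|lborel. norm (k j * p j \<tau>)) = (LINT \<tau>|lborel. sgn (k j) * (k j * p j \<tau>))"
      using p0 by (intro Bochner_Integration.integral_cong) (auto simp: abs_mult abs_sgn[of "k j"] mult_ac)
    also have "\<dots> = sgn (k j) * (Gamma (1/2) * v j)" using bi[of j] by (simp add: has_bochner_integral_iff)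
    finally have eq: "(LINT \<tau>|lborel. norm (k j * p j \<tau>)) = sgn (k j) * (Gamma (1/2) * v j)" .
    have "\<bar>sgn (k j) * (Gamma (1/2) * v j)\<bar> = \<bar>Gamma (1/2) * v j\<bar>" if "k j \<noteq> 0"
      using that by (simp add: abs_mult abs_sgn_eq)
    moreover have "Gamma (1/2) * v j = 0" if "k j = 0"
      using bi[of j] that by (simp add: has_bochner_integral_iff)
    moreover have "(LINT \<tau>|lborel. norm (k j * p j \<tau>)) \<ge> 0" by (rule integral_nonneg_AE) simp
    ultimately show ?thesis using eq by (cases "k j = 0") auto
  qed
  have sumv: "summable (\<lambda>j. \<bar>v j\<bar>)" unfolding v_def by (rule frac_series_summable(1)[OF h t])
  have int: "integrable lborel (\<lambda>\<tau>. k j * p j \<tau>)" for j using bi[of j] by (simp add: has_bochner_integral_iff)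
  have ae: "AE \<tau> in lborel. summable (\<lambda>j. norm (k j * p j \<tau>))"
  proof (rule AE_I2)
    fix \<tau>
    show "summable (\<lambda>j. norm (k j * p j \<tau>))"
    proof (cases "\<tau> \<in> {0<..<t}")
      case True
      then have "summable (\<lambda>j. \<bar>h j * rGamma (\<beta> + 1 + real j / 2) * \<tau> powr (\<beta> + real j / 2)\<bar> * (1 / (t - \<tau>) powr (1/2)))"
        by (intro summable_mult2 frac_series_summable h) simp
      then show ?thesis using True by (simp add: k_def p_def abs_mult)
    qed (simp add: p_def)
  qed
  have si: "summable (\<lambda>j. LINT \<tau>|lborel. norm (k j * p j \<tau>))"
    unfolding abs abs_mult by (rule summable_mult[OF sumv])
  have eq: "(\<Sum>j. k j * p j \<tau>) = indicator {0<..<t} \<tau> *\<^sub>R (frac_series h \<beta> \<tau> / (t - \<tau>) powr (1/2))" for \<tau>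
    using suminf_divide[OF frac_series_summable(2)[OF h, of \<tau> \<beta>], of "(t - \<tau>) powr (1/2)"]
    by (cases "\<tau> \<in> {0<..<t}") (auto simp: p_def k_def frac_series_def)
  show "set_integrable lborel {0<..<t} (\<lambda>\<tau>. frac_series h \<beta> \<tau> / (t - \<tau>) powr (1/2))"
    using integrable_suminf[OF int ae si] unfolding eq set_integrable_def .
  show "(LINT \<tau>:{0<..<t}|lborel. frac_series h \<beta> \<tau> / (t - \<tau>) powr (1/2)) = Gamma (1/2) * frac_series h (\<beta> + 1/2) t"
  proof -
    have "(LINT \<tau>:{0<..<t}|lborel. frac_series h \<beta> \<tau> / (t - \<tau>) powr (1/2)) = (\<Sum>j. Gamma (1/2) * v j)"
      using integral_suminf[OF int ae si] bi unfolding eq set_lebesgue_integral_def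
      by (simp add: has_bochner_integral_iff)
    also have "\<dots> = Gamma (1/2) * (\<Sum>j. v j)" by (rule suminf_mult[OF summable_rabs_cancel[OF sumv]])
    finally show ?thesis unfolding frac_series_def v_def .
  qed
qed

lemma frac_series_unfold:
  assumes "geom_bounded h" "t > 0"
  shows "frac_series h \<beta> t = h 0 * rGamma (\<beta> + 1) * t powr \<beta> + frac_series (\<lambda>j. h (Suc j)) (\<beta> + 1/2) t"
  using suminf_split_head[OF frac_series_summable(2)[OF assms, of \<beta>]]
  by (simp add: frac_series_def add_divide_distrib add_ac)

lemma frac_series_add:
  assumes "geom_bounded u" "geom_bounded v" "t > 0"
  shows "frac_series (\<lambda>j. u j + v j) \<beta> t = frac_series u \<beta> t + frac_series v \<beta> t"
  using suminf_add[OF frac_series_summable(2)[OF assms(1,3), of \<beta>] frac_series_summable(2)[OF assms(2,3), of \<beta>]]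
  by (simp add: frac_series_def distrib_right)

lemma frac_series_cmult:
  assumes "geom_bounded u" "t > 0"
  shows "frac_series (\<lambda>j. x * u j) \<beta> t = x * frac_series u \<beta> t"
  using suminf_mult[OF frac_series_summable(2)[OF assms, of \<beta>], of x]
  by (simp add: frac_series_def mult_ac)

lemma geom_bounded_shift:
  assumes "geom_bounded h"
  shows "geom_bounded (\<lambda>j. h (j + m))"
proof -
  from assms obtain K \<rho> where K: "K \<ge> 0" "\<rho> \<ge> 0" "\<And>j. \<bar>h j\<bar> \<le> K * \<rho> ^ j"
    unfolding geom_bounded_def by auto
  have "\<bar>h (j + m)\<bar> \<le> (K * \<rho> ^ m) * \<rho> ^ j" for j using K(3)[of "j + m"] by (simp add: power_add mult_ac)
  moreover have "K * \<rho> ^ m \<ge> 0" using K by simp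
  ultimately show ?thesis unfolding geom_bounded_def using K by blast
qed

lemma geom_bounded_cmult:
  assumes "geom_bounded h"
  shows "geom_bounded (\<lambda>j. x * h j)"
proof -
  from assms obtain K \<rho> where K: "K \<ge> 0" "\<rho> \<ge> 0" "\<And>j. \<bar>h j\<bar> \<le> K * \<rho> ^ j"
    unfolding geom_bounded_def by auto
  have "\<bar>x * h j\<bar> \<le> (\<bar>x\<bar> * K) * \<rho> ^ j" for j
    using mult_left_mono[OF K(3)[of j], of "\<bar>x\<bar>"] by (simp add: abs_mult mult_ac)
  moreover have "\<bar>x\<bar> * K \<ge> 0" using K by simp
  ultimately show ?thesis unfolding geom_bounded_def using K by blast
qed

lemma frac_series_at_0 [simp]: "frac_series h \<beta> 0 = 0"
  by (simp add: frac_series_def)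

lemma frac_series_zero [simp]: "frac_series (\<lambda>j. 0) \<beta> t = 0"
  by (simp add: frac_series_def)

section \<open>The complementary error function as a Mittag-Leffler function\<close>

lemma mittag_leffler_half_sums:
  "(\<lambda>j. of_real (rGamma (\<beta> + 1 + real j / 2)) * z ^ j) sums mittag_leffler (1/2) (of_real \<beta> + 1) z"
proof -
  have "z ^ j / Gamma (1/2 * of_nat j + (of_real \<beta> + 1)) = of_real (rGamma (\<beta> + 1 + real j / 2)) * z ^ j" for j
  proof -
    have eq: "1/2 * of_nat j + (of_real \<beta> + 1) = complex_of_real (\<beta> + 1 + real j / 2)" by simp
    show ?thesis unfolding eq
      by (simp only: Gamma_complex_of_real rGamma_inverse_Gamma of_real_inverse divide_inverse mult.commute)
  qed
  moreover have "summable (\<lambda>j. of_real (rGamma (\<beta> + 1 + real j / 2)) * z ^ j)"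
    by (rule summable_norm_cancel)
       (use summable_rGamma_half_power[of "norm z" "\<beta> + 1"] in \<open>simp add: norm_mult norm_power mult.commute\<close>)
  ultimately show ?thesis unfolding mittag_leffler_def by (simp add: summable_sums)
qed

text \<open>
  Termwise differentiation shifts the second parameter from \<open>1\<close> to \<open>1/2\<close>; shifting the summation index
  back gives the differential equation satisfied by \<open>exp (z\<^sup>2) erfc (- z)\<close>.
\<close>

lemma mittag_leffler_half_one_derivative:
  "(mittag_leffler (1/2) 1 has_field_derivative 2 / of_real (sqrt pi) + 2 * z * mittag_leffler (1/2) 1 z) (at z)"
proof -
  define k where "k j = complex_of_real (rGamma (1 + real j / 2))" for j
  have sums: "(\<lambda>j. k j * x ^ j) sums mittag_leffler (1/2) 1 x" for x
    using mittag_leffler_half_sums[of 0 x] by (simp add: k_def)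
  have series: "mittag_leffler (1/2) 1 = (\<lambda>x. \<Sum>j. k j * x ^ j)"
    using sums by (intro ext sums_unique)
  have der: "(mittag_leffler (1/2) 1 has_field_derivative (\<Sum>j. diffs k j * z ^ j)) (at z)"
    unfolding series by (rule termdiffs_strong_converges_everywhere) (rule sums_summable[OF sums])
  have d: "diffs k j = 2 * of_real (rGamma (1/2 + real j / 2))" for j
  proof -
    have "(1/2 + real j / 2) * rGamma (1 + real (Suc j) / 2) = rGamma (1/2 + real j / 2)"
      using rGamma_plus1[of "1/2 + real j / 2"] by (simp add: field_simps)
    then have "real (Suc j) * rGamma (1 + real (Suc j) / 2) = 2 * rGamma (1/2 + real j / 2)" by (simp add: field_simps)
    then show ?thesis unfolding diffs_def k_def by (metis of_real_mult of_real_numeral of_real_of_nat_eq)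
  qed
  have eq: "(\<lambda>j. diffs k (Suc j) * z ^ Suc j) = (\<lambda>j. 2 * z * (k j * z ^ j))"
    unfolding d k_def by (intro ext) (simp add: add_divide_distrib)
  have "(\<lambda>j. diffs k (Suc j) * z ^ Suc j) sums (2 * z * mittag_leffler (1/2) 1 z)"
    unfolding eq by (rule sums_mult[OF sums])
  then have "(\<lambda>j. diffs k j * z ^ j) sums (2 * z * mittag_leffler (1/2) 1 z + diffs k 0 * z ^ 0)"
    by (subst (asm) sums_Suc_iff) simp
  moreover have "diffs k 0 = 2 / of_real (sqrt pi)"
  proof -
    have "rGamma (1/2 :: real) = 1 / sqrt pi"
      by (simp add: rGamma_inverse_Gamma Gamma_one_half_real inverse_eq_divide)
    then show ?thesis unfolding d by simp
  qed
  ultimately show ?thesis using der by (simp add: sums_unique[symmetric] add.commute)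
qed

text \<open>
  By the differential equation, \<open>exp (- u\<^sup>2) E(- u)\<close> is a primitive of \<open>exp (- u\<^sup>2)\<close> up to the
  factor \<open>- \<surd>\<pi>/2\<close>, where \<open>E\<close> is the Mittag-Leffler function with parameters \<open>1/2\<close> and \<open>1\<close>.  So it
  evaluates the contour integral that defines \<open>erfc\<close>.
\<close>

lemma exp_erfc_eq_mittag_leffler: "exp (z\<^sup>2) * erfc (- z) = mittag_leffler (1/2) 1 z"
proof -
  define \<phi> where "\<phi> = mittag_leffler (1/2) 1"
  define G where "G u = - (of_real (sqrt pi) / 2) * (exp (- (u\<^sup>2)) * \<phi> (- u))" for u
  have \<phi>0: "\<phi> 0 = 1"
  proof -
    have "(\<lambda>j. of_real (rGamma (1 + real j / 2)) * 0 ^ j) sums \<phi> 0"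
      using mittag_leffler_half_sums[of 0 0] by (simp add: \<phi>_def)
    then show ?thesis using powser_sums_zero_iff[of "\<lambda>j. of_real (rGamma (1 + real j / 2))"] by simp
  qed
  have pi0: "complex_of_real (sqrt pi) \<noteq> 0" by simp
  have der: "(G has_field_derivative exp (- (u\<^sup>2))) (at u within UNIV)" for u
  proof -
    have "((\<lambda>u. \<phi> (- u)) has_field_derivative (2 / of_real (sqrt pi) + 2 * (- u) * \<phi> (- u)) * (- 1)) (at u)"
      unfolding \<phi>_def
      by (rule DERIV_chain'[OF _ mittag_leffler_half_one_derivative]) (auto intro!: derivative_eq_intros)
    note [derivative_intros] = this
    show ?thesis unfolding G_def
      by (rule derivative_eq_intros refl | simp)+ (use pi0 in \<open>simp add: field_simps\<close>)
  qed
  have "((\<lambda>u. exp (- (u\<^sup>2))) has_contour_integral G (pathfinish (linepath 0 (- z))) - G (pathstart (linepath 0 (- z)))) (linepath 0 (- z))"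
    by (rule contour_integral_primitive[OF der]) auto
  then have "contour_integral (linepath 0 (- z)) (\<lambda>u. exp (- (u\<^sup>2))) = G (- z) - G 0"
    by (simp add: contour_integral_unique)
  also have "\<dots> = of_real (sqrt pi) / 2 * (1 - exp (- (z\<^sup>2)) * \<phi> z)"
    by (simp add: G_def \<phi>0 algebra_simps)
  finally have ci: "contour_integral (linepath 0 (- z)) (\<lambda>u. exp (- (u\<^sup>2)))
      = of_real (sqrt pi) / 2 * (1 - exp (- (z\<^sup>2)) * \<phi> z)" .
  have "erfc (- z) = exp (- (z\<^sup>2)) * \<phi> z" unfolding erfc_def ci using pi0 by (simp add: diff_divide_distrib)
  then show ?thesis by (simp add: \<phi>_def exp_minus)
qed

text \<open>
  Exchanging the finite sum over the roots with the series.
\<close>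

lemma frac_series_eq_mittag_leffler_sum:
  assumes u: "geom_bounded u" "\<And>j. of_real (u j) = (\<Sum>k\<in>I. A k * r k ^ j)" and t: "t > 0"
  shows "of_real (t powr \<beta>) * (\<Sum>k\<in>I. A k * mittag_leffler (1/2) (of_real \<beta> + 1) (r k * of_real (sqrt t)))
    = of_real (frac_series u \<beta> t)"
proof -
  have "(\<lambda>j. of_real (t powr \<beta>) * (\<Sum>k\<in>I. A k * (of_real (rGamma (\<beta> + 1 + real j / 2)) * (r k * of_real (sqrt t)) ^ j)))
     sums (of_real (t powr \<beta>) * (\<Sum>k\<in>I. A k * mittag_leffler (1/2) (of_real \<beta> + 1) (r k * of_real (sqrt t))))"
    by (intro sums_mult sums_sum mittag_leffler_half_sums)
  moreover have "of_real (t powr \<beta>) * (\<Sum>k\<in>I. A k * (of_real (rGamma (\<beta> + 1 + real j / 2)) * (r k * of_real (sqrt t)) ^ j))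
     = complex_of_real (u j * rGamma (\<beta> + 1 + real j / 2) * t powr (\<beta> + real j / 2))" for j
    unfolding powr_half_nat[OF t] of_real_mult u(2)
    by (simp add: sum_distrib_left sum_distrib_right power_mult_distrib mult_ac)
  moreover have "(\<lambda>j. complex_of_real (u j * rGamma (\<beta> + 1 + real j / 2) * t powr (\<beta> + real j / 2))) sums of_real (frac_series u \<beta> t)"
    unfolding frac_series_def by (intro sums_of_real summable_sums frac_series_summable u t)
  ultimately show ?thesis by (simp only:) (rule sums_unique2)
qed


section \<open>Weakly singular integral inequalities\<close>

text \<open>
  The gamma integral, rescaled: the Laplace transform of the kernel \<open>s\<^sup>-\<^sup>1\<^sup>/\<^sup>2\<close>.
\<close>

lemma nn_integral_exp_kernel:
  assumes "\<mu> > (0::real)"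
  shows "(\<integral>\<^sup>+s. ennreal (indicator {0<..} s * exp (- \<mu> * s) / s powr (1/2)) \<partial>lborel) = ennreal (Gamma (1/2) / sqrt \<mu>)"
proof -
  define f where "f t = ennreal (indicator {0..} t * t powr (1/2 - 1) / exp t)" for t :: real
  define g where "g s = ennreal (indicator {0<..} s * exp (- \<mu> * s) / s powr (1/2))" for s :: real
  have [measurable]: "f \<in> borel_measurable borel" "g \<in> borel_measurable borel"
    unfolding f_def g_def by measurable
  have fg: "f (0 + \<mu> * s) = ennreal (1 / sqrt \<mu>) * g s" for s
  proof (cases "s > 0")
    case True
    have "(\<mu> * s) powr (1/2 - 1) = 1 / sqrt \<mu> * (1 / s powr (1/2))"
      using True assms powr_minus_divide[of "\<mu> * s" "1/2"] by (simp add: powr_mult powr_half_sqrt)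
    then have "(\<mu> * s) powr (1/2 - 1) / exp (\<mu> * s) = 1 / sqrt \<mu> * (exp (- \<mu> * s) / s powr (1/2))"
      by (simp add: exp_minus divide_simps)
    then show ?thesis using True assms by (simp add: f_def g_def flip: ennreal_mult)
  next
    case False
    then have "\<mu> * s \<le> 0" using assms by (simp add: mult_nonneg_nonpos)
    then show ?thesis using False by (cases "\<mu> * s = 0") (auto simp: f_def g_def)
  qed
  have "ennreal (Gamma (1/2)) = (\<integral>\<^sup>+t. f t \<partial>lborel)"
    unfolding f_def by (rule Gamma_conv_nn_integral_real) simp
  also have "\<dots> = ennreal \<mu> * (\<integral>\<^sup>+s. f (0 + \<mu> * s) \<partial>lborel)"
    using nn_integral_real_affine[of f \<mu> 0] assms by simp
  also have "\<dots> = ennreal \<mu> * (ennreal (1 / sqrt \<mu>) * (\<integral>\<^sup>+s. g s \<partial>lborel))"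
    unfolding fg by (subst nn_integral_cmult) auto
  also have "\<dots> = ennreal (sqrt \<mu>) * (\<integral>\<^sup>+s. g s \<partial>lborel)"
  proof -
    have "ennreal \<mu> * ennreal (1 / sqrt \<mu>) = ennreal (sqrt \<mu>)"
      using assms by (simp add: ennreal_mult[symmetric] real_div_sqrt)
    then show ?thesis by (simp add: mult.assoc[symmetric])
  qed
  finally have "ennreal (1 / sqrt \<mu>) * ennreal (Gamma (1/2)) = ennreal (1 / sqrt \<mu>) * (ennreal (sqrt \<mu>) * (\<integral>\<^sup>+s. g s \<partial>lborel))"
    by simp
  also have "\<dots> = (\<integral>\<^sup>+s. g s \<partial>lborel)"
    using assms by (simp add: mult.assoc[symmetric] ennreal_mult[symmetric])
  finally show ?thesis
    unfolding g_def using assms by (simp add: ennreal_mult[symmetric] Gamma_real_nonneg)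
qed

text \<open>
  Up to the factor \<open>\<Gamma>(1/2)\<close> the half integral of \<open>|w|\<close>.  With values in the extended nonnegative reals
  it is defined for every \<open>w\<close>, and Tonelli's theorem applies to it.
\<close>

definition half_conv :: "(real \<Rightarrow> real) \<Rightarrow> real \<Rightarrow> ennreal" where
  "half_conv w t = (\<integral>\<^sup>+\<tau>. ennreal (indicator {0<..<t} \<tau> * (\<bar>w \<tau>\<bar> / (t - \<tau>) powr (1/2))) \<partial>lborel)"

lemma half_conv_measurable [measurable]:
  assumes [measurable]: "w \<in> borel_measurable borel"
  shows "half_conv w \<in> borel_measurable borel"
proof -
  have "half_conv w = (\<lambda>t. \<integral>\<^sup>+\<tau>. ennreal (if 0 < \<tau> \<and> \<tau> < t then \<bar>w \<tau>\<bar> / (t - \<tau>) powr (1/2) else 0) \<partial>lborel)"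
    by (intro ext) (auto simp: half_conv_def intro!: nn_integral_cong)
  then show ?thesis by simp
qed

text \<open>
  Writing \<open>exp (- \<mu> t) = exp (- \<mu> \<tau>) exp (- \<mu> (t - \<tau>))\<close> makes the left side at most the integral of a
  convolution, and Tonelli's theorem splits that into the product on the right.
\<close>

lemma half_conv_weighted:
  assumes v[measurable]: "v \<in> borel_measurable borel" and \<mu>: "\<mu> > 0"
  shows "(\<integral>\<^sup>+t. ennreal (indicator {0<..<T} t * exp (- \<mu> * t)) * half_conv v t \<partial>lborel)
    \<le> ennreal (Gamma (1/2) / sqrt \<mu>) * (\<integral>\<^sup>+t. ennreal (indicator {0<..<T} t * exp (- \<mu> * t) * \<bar>v t\<bar>) \<partial>lborel)"
proof -
  define k where "k s = ennreal (indicator {0<..} s * exp (- \<mu> * s) / s powr (1/2))" for s :: real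
  define V where "V \<tau> = ennreal (indicator {0<..<T} \<tau> * exp (- \<mu> * \<tau>) * \<bar>v \<tau>\<bar>)" for \<tau>
  have [measurable]: "k \<in> borel_measurable borel" "V \<in> borel_measurable borel"
    unfolding k_def V_def by measurable
  have "ennreal (indicator {0<..<T} t * exp (- \<mu> * t)) * half_conv v t \<le> (\<integral>\<^sup>+\<tau>. V \<tau> * k (t - \<tau>) \<partial>lborel)" for t
  proof (cases "t \<in> {0<..<T}")
    case True
    have "ennreal (indicator {0<..<T} t * exp (- \<mu> * t)) * half_conv v t =
      (\<integral>\<^sup>+\<tau>. ennreal (exp (- \<mu> * t)) * ennreal (indicator {0<..<t} \<tau> * (\<bar>v \<tau>\<bar> / (t - \<tau>) powr (1/2))) \<partial>lborel)"
      using True unfolding half_conv_def by (subst nn_integral_cmult) auto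
    also have "\<dots> \<le> (\<integral>\<^sup>+\<tau>. V \<tau> * k (t - \<tau>) \<partial>lborel)"
    proof (rule nn_integral_mono)
      fix \<tau>
      show "ennreal (exp (- \<mu> * t)) * ennreal (indicator {0<..<t} \<tau> * (\<bar>v \<tau>\<bar> / (t - \<tau>) powr (1/2))) \<le> V \<tau> * k (t - \<tau>)"
      proof (cases "\<tau> \<in> {0<..<t}")
        case True
        have e: "exp (- (\<mu> * t)) = exp (- (\<mu> * \<tau>)) * exp (- (\<mu> * (t - \<tau>)))"
          by (simp add: exp_add[symmetric] algebra_simps)
        show ?thesis using True \<open>t \<in> {0<..<T}\<close> by (simp add: V_def k_def e mult_ac flip: ennreal_mult)
      qed simp
    qed
    finally show ?thesis .
  qed simp
  then have "(\<integral>\<^sup>+t. ennreal (indicator {0<..<T} t * exp (- \<mu> * t)) * half_conv v t \<partial>lborel)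
      \<le> (\<integral>\<^sup>+t. (\<integral>\<^sup>+\<tau>. V \<tau> * k (t - \<tau>) \<partial>lborel) \<partial>lborel)" by (rule nn_integral_mono)
  also have "\<dots> = (\<integral>\<^sup>+\<tau>. (\<integral>\<^sup>+t. V \<tau> * k (t - \<tau>) \<partial>lborel) \<partial>lborel)"
    by (rule lborel_pair.Fubini') measurable
  also have "\<dots> = (\<integral>\<^sup>+\<tau>. V \<tau> * (\<integral>\<^sup>+s. k s \<partial>lborel) \<partial>lborel)"
  proof (rule nn_integral_cong)
    fix \<tau>
    have "(\<integral>\<^sup>+t. V \<tau> * k (t - \<tau>) \<partial>lborel) = V \<tau> * (\<integral>\<^sup>+t. k (t - \<tau>) \<partial>lborel)"
      by (rule nn_integral_cmult) measurable
    also have "(\<integral>\<^sup>+t. k (t - \<tau>) \<partial>lborel) = (\<integral>\<^sup>+s. k s \<partial>lborel)"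
      using nn_integral_real_affine[of k 1 "- \<tau>"] by simp
    finally show "(\<integral>\<^sup>+t. V \<tau> * k (t - \<tau>) \<partial>lborel) = V \<tau> * (\<integral>\<^sup>+s. k s \<partial>lborel)" .
  qed
  also have "\<dots> = (\<integral>\<^sup>+s. k s \<partial>lborel) * (\<integral>\<^sup>+\<tau>. V \<tau> \<partial>lborel)"
    by (subst nn_integral_multc) (auto simp: mult.commute)
  also have "(\<integral>\<^sup>+s. k s \<partial>lborel) = ennreal (Gamma (1/2) / sqrt \<mu>)"
    unfolding k_def by (rule nn_integral_exp_kernel[OF \<mu>])
  finally show ?thesis unfolding V_def .
qed

text \<open>
  For \<open>\<mu> = (2 M \<Gamma>(1/2))\<^sup>2\<close> the weighted \<open>L\<^sup>1\<close> norm of \<open>w\<close> is finite and at most half of itself.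
\<close>

lemma half_conv_inequality_imp_zero:
  assumes w: "set_integrable lborel {0<..<T} w" and [measurable]: "w \<in> borel_measurable borel"
    and le: "\<And>t. 0 < t \<Longrightarrow> t < T \<Longrightarrow> ennreal \<bar>w t\<bar> \<le> ennreal M * half_conv w t" and M: "M > 0"
  shows "AE t in lborel. t \<in> {0<..<T} \<longrightarrow> w t = 0"
proof -
  define \<mu> where "\<mu> = (2 * M * Gamma (1/2))\<^sup>2"
  have G: "Gamma (1/2 :: real) > 0" by (rule Gamma_real_pos) simp
  have \<mu>: "\<mu> > 0" "sqrt \<mu> = 2 * M * Gamma (1/2)" using M G less_imp_neq[OF G] by (simp_all add: \<mu>_def)
  define I where "I = (\<integral>\<^sup>+t. ennreal (indicator {0<..<T} t * exp (- \<mu> * t) * \<bar>w t\<bar>) \<partial>lborel)"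
  have "I \<le> (\<integral>\<^sup>+t. ennreal (norm (indicator {0<..<T} t *\<^sub>R w t)) \<partial>lborel)"
    unfolding I_def using \<mu> by (intro nn_integral_mono ennreal_leI) (auto simp: indicator_def mult_left_le_one_le)
  also have "\<dots> < \<infinity>" using w unfolding set_integrable_def integrable_iff_bounded by simp
  finally have fin: "I < \<infinity>" .
  have "I \<le> (\<integral>\<^sup>+t. ennreal M * (ennreal (indicator {0<..<T} t * exp (- \<mu> * t)) * half_conv w t) \<partial>lborel)"
    unfolding I_def
  proof (rule nn_integral_mono)
    fix t
    show "ennreal (indicator {0<..<T} t * exp (- \<mu> * t) * \<bar>w t\<bar>) \<le> ennreal M * (ennreal (indicator {0<..<T} t * exp (- \<mu> * t)) * half_conv w t)"
    proof (cases "t \<in> {0<..<T}")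
      case True
      then have "ennreal (exp (- \<mu> * t)) * ennreal \<bar>w t\<bar> \<le> ennreal (exp (- \<mu> * t)) * (ennreal M * half_conv w t)"
        by (intro mult_left_mono le) auto
      then show ?thesis using True by (simp add: ennreal_mult mult_ac)
    qed simp
  qed
  also have "\<dots> \<le> ennreal M * (\<integral>\<^sup>+t. (ennreal (indicator {0<..<T} t * exp (- \<mu> * t)) * half_conv w t) \<partial>lborel)"
    by (subst nn_integral_cmult) auto
  also have "\<dots> \<le> ennreal M * (ennreal (Gamma (1/2) / sqrt \<mu>) * I)"
    unfolding I_def by (intro mult_left_mono half_conv_weighted \<mu>) simp_all
  also have "\<dots> = ennreal (1/2) * I"
  proof -
    have "ennreal M * ennreal (Gamma (1/2) / sqrt \<mu>) = ennreal (1/2)"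
      using M G less_imp_neq[OF G] unfolding \<mu>(2) by (simp add: ennreal_mult[symmetric])
    then show ?thesis by (simp add: mult.assoc[symmetric])
  qed
  finally have le: "I \<le> ennreal (1/2) * I" .
  obtain r where r: "I = ennreal r" "r \<ge> 0" using fin by (cases I) auto
  have "ennreal r \<le> ennreal (1/2 * r)" using le r by (simp only: ennreal_mult)
  then have "I = 0" using r by (simp add: ennreal_le_iff)
  then have "AE t in lborel. ennreal (indicator {0<..<T} t * exp (- \<mu> * t) * \<bar>w t\<bar>) = 0"
    unfolding I_def by (subst (asm) nn_integral_0_iff_AE) auto
  then show ?thesis by eventually_elim (auto simp: indicator_def)
qed


lemma half_conv_cong:
  assumes "\<And>\<tau>. 0 < \<tau> \<Longrightarrow> \<tau> < t \<Longrightarrow> w \<tau> = v \<tau>"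
  shows "half_conv w t = half_conv v t"
  unfolding half_conv_def using assms by (intro nn_integral_cong) (auto simp: indicator_def)

text \<open>
  On \<open>(0, t)\<close> the kernel \<open>(t - \<tau>)\<^sup>-\<^sup>1\<^sup>/\<^sup>2\<close> is at least \<open>t\<^sup>-\<^sup>1\<^sup>/\<^sup>2\<close>, so integrability against the kernel
  implies plain integrability.
\<close>

lemma set_integrable_half_kernel:
  assumes "set_integrable lborel {0<..<t} (\<lambda>\<tau>. w \<tau> / (t - \<tau>) powr (1/2))"
  shows "set_integrable lborel {0<..<t} w"
    and "ennreal (LINT \<tau>:{0<..<t}|lborel. \<bar>w \<tau>\<bar>) \<le> ennreal (t powr (1/2)) * half_conv w t"
    and "ennreal \<bar>LINT \<tau>:{0<..<t}|lborel. w \<tau> / (t - \<tau>) powr (1/2)\<bar> \<le> half_conv w t"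
proof -
  define g where "g \<tau> = indicator {0<..<t} \<tau> *\<^sub>R (w \<tau> / (t - \<tau>) powr (1/2))" for \<tau>
  have g: "integrable lborel g" using assms by (simp add: set_integrable_def g_def[abs_def])
  then have [measurable]: "g \<in> borel_measurable borel" by simp
  have wg: "indicator {0<..<t} \<tau> *\<^sub>R w \<tau> = g \<tau> * (indicator {0<..<t} \<tau> * (t - \<tau>) powr (1/2))" for \<tau>
    by (auto simp: g_def indicator_def)
  have kb: "\<bar>indicator {0<..<t} \<tau> * (t - \<tau>) powr (1/2)\<bar> \<le> t powr (1/2)" for \<tau>
    by (auto simp: indicator_def intro!: powr_mono2)
  show int: "set_integrable lborel {0<..<t} w"
    unfolding set_integrable_def wg
  proof (rule Bochner_Integration.integrable_bound)
    show "integrable lborel (\<lambda>\<tau>. g \<tau> * t powr (1/2))" using g by simp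
    show "(\<lambda>\<tau>. g \<tau> * (indicator {0<..<t} \<tau> * (t - \<tau>) powr (1/2))) \<in> borel_measurable lborel" by measurable
    show "AE \<tau> in lborel. norm (g \<tau> * (indicator {0<..<t} \<tau> * (t - \<tau>) powr (1/2))) \<le> norm (g \<tau> * t powr (1/2))"
      using kb by (intro AE_I2) (auto simp: abs_mult intro!: mult_left_mono)
  qed
  have absg: "\<bar>g \<tau>\<bar> = indicator {0<..<t} \<tau> * (\<bar>w \<tau>\<bar> / (t - \<tau>) powr (1/2))" for \<tau>
    by (auto simp: g_def indicator_def)
  have hc: "half_conv w t = ennreal (LINT \<tau>|lborel. \<bar>g \<tau>\<bar>)"
    unfolding half_conv_def absg[symmetric] using g by (intro nn_integral_eq_integral) auto
  have "(LINT \<tau>:{0<..<t}|lborel. \<bar>w \<tau>\<bar>) \<le> (LINT \<tau>|lborel. t powr (1/2) * \<bar>g \<tau>\<bar>)"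
    unfolding set_lebesgue_integral_def
  proof (rule integral_mono)
    show "integrable lborel (\<lambda>\<tau>. indicator {0<..<t} \<tau> *\<^sub>R \<bar>w \<tau>\<bar>)"
      using set_integrable_abs[OF int] by (simp add: set_integrable_def)
    show "integrable lborel (\<lambda>\<tau>. t powr (1/2) * \<bar>g \<tau>\<bar>)" using g by simp
    fix \<tau>
    have "indicator {0<..<t} \<tau> *\<^sub>R \<bar>w \<tau>\<bar> = \<bar>g \<tau>\<bar> * \<bar>indicator {0<..<t} \<tau> * (t - \<tau>) powr (1/2)\<bar>"
      using arg_cong[OF wg[of \<tau>], of abs] by (simp add: abs_mult)
    also have "\<dots> \<le> \<bar>g \<tau>\<bar> * t powr (1/2)" using kb by (intro mult_left_mono) auto
    finally show "indicator {0<..<t} \<tau> *\<^sub>R \<bar>w \<tau>\<bar> \<le> t powr (1/2) * \<bar>g \<tau>\<bar>" by (simp add: mult.commute)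
  qed
  then show "ennreal (LINT \<tau>:{0<..<t}|lborel. \<bar>w \<tau>\<bar>) \<le> ennreal (t powr (1/2)) * half_conv w t"
    unfolding hc by (simp add: ennreal_leI flip: ennreal_mult)
  have "\<bar>LINT \<tau>|lborel. g \<tau>\<bar> \<le> (LINT \<tau>|lborel. \<bar>g \<tau>\<bar>)" by (rule integral_abs_bound)
  then show "ennreal \<bar>LINT \<tau>:{0<..<t}|lborel. w \<tau> / (t - \<tau>) powr (1/2)\<bar> \<le> half_conv w t"
    unfolding hc set_lebesgue_integral_def g_def[symmetric] by (rule ennreal_leI)
qed

text \<open>
  Near \<open>0\<close>, \<open>z'\<close> is only controlled through the one-sided derivative of \<open>z\<close> at \<open>0\<close>: the mean value
  theorem supplies points \<open>s\<close> arbitrarily close to \<open>0\<close> at which \<open>z' s\<close> is small, and from there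
  \<open>z'\<close> is controlled by integrating \<open>w\<close>.
\<close>

lemma bound_by_second_derivative:
  fixes z z' w :: "real \<Rightarrow> real"
  assumes z0: "z 0 = 0" "(z has_real_derivative 0) (at 0 within {0..})"
    and z': "\<And>s. s > 0 \<Longrightarrow> (z has_real_derivative z' s) (at s)"
    and w: "\<And>s. s > 0 \<Longrightarrow> (z' has_real_derivative w s) (at s)"
    and int: "set_integrable lborel {0<..<t} w" and t: "t > 0"
  shows "\<bar>z t\<bar> \<le> t * (LINT \<tau>:{0<..<t}|lborel. \<bar>w \<tau>\<bar>)"
proof -
  define J where "J = (LINT \<tau>:{0<..<t}|lborel. \<bar>w \<tau>\<bar>)"
  have incr: "\<bar>z' x - z' s\<bar> \<le> J" if "0 < s" "s < x" "x < t" for s x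
  proof -
    have sub: "{s..x} \<subseteq> {0<..<t}" using that by auto
    have int': "set_integrable lborel {s..x} w" by (rule set_integrable_subset[OF int _ sub]) simp
    have "(w has_integral (z' x - z' s)) {s..x}"
    proof (rule fundamental_theorem_of_calculus)
      fix q assume "q \<in> {s..x}"
      then have "(z' has_real_derivative w q) (at q)" using that by (intro w) auto
      then show "(z' has_vector_derivative w q) (at q within {s..x})"
        unfolding has_real_derivative_iff_has_vector_derivative[symmetric]
        by (rule has_field_derivative_at_within)
    qed (use that in simp)
    then have "z' x - z' s = (LINT \<tau>:{s..x}|lborel. w \<tau>)"
      using set_borel_integral_eq_integral(2)[OF int'] by (simp add: integral_unique)
    also have "\<bar>\<dots>\<bar> \<le> (LINT \<tau>:{s..x}|lborel. \<bar>w \<tau>\<bar>)"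
      unfolding set_lebesgue_integral_def
      by (rule order_trans[OF integral_abs_bound]) (simp add: abs_mult)
    also have "\<dots> \<le> J"
      unfolding J_def set_lebesgue_integral_def
      using set_integrable_abs[OF int'] set_integrable_abs[OF int] sub
      by (intro integral_mono) (auto simp: set_integrable_def indicator_def)
    finally show ?thesis .
  qed
  have cont: "continuous_on {0..x} z" for x
  proof (unfold continuous_on_eq_continuous_within, intro ballI)
    fix s assume s: "s \<in> {0..x}"
    show "continuous (at s within {0..x}) z"
    proof (cases "s = 0")
      case True
      have "continuous (at 0 within {0..}) z" using z0(2) by (rule DERIV_continuous)
      then show ?thesis unfolding True by (rule continuous_within_subset) auto
    next
      case False
      then show ?thesis using s z'[of s] by (auto intro: continuous_at_imp_continuous_at_within DERIV_isCont)
    qed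
  qed
  have mean: "\<exists>s. 0 < s \<and> s < x \<and> z x = x * z' s" if x: "x > 0" for x
  proof -
    obtain s where "0 < s" "s < x" "z x - z 0 = z' s * (x - 0)"
      by (rule mvt[OF x cont, of "\<lambda>s. (*) (z' s)"])
         (auto intro: has_field_derivative_imp_has_derivative z')
    then show ?thesis using z0 by (auto simp: mult.commute)
  qed
  have z'_le: "\<bar>z' x\<bar> \<le> J" if x: "0 < x" "x < t" for x
  proof (rule field_le_epsilon)
    fix e :: real assume e: "e > 0"
    have "((\<lambda>y. (z y - z 0) / (y - 0)) \<longlongrightarrow> 0) (at 0 within {0..})"
      using z0(2) by (simp add: has_field_derivative_iff)
    from tendstoD[OF this e] obtain d where d: "d > 0" "\<And>y. y \<ge> 0 \<Longrightarrow> y \<noteq> 0 \<Longrightarrow> \<bar>y\<bar> < d \<Longrightarrow> \<bar>z y / y\<bar> < e"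
      unfolding eventually_at using z0 by (auto simp: dist_real_def)
    define h where "h = min (d/2) x"
    have h: "h > 0" "h < d" "h \<le> x" using d(1) x by (auto simp: h_def)
    from mean[OF h(1)] obtain s where s: "0 < s" "s < h" "z h = h * z' s" by blast
    have "\<bar>z' s\<bar> < e" using d(2)[of h] h s by simp
    moreover have "\<bar>z' x - z' s\<bar> \<le> J" using s h x by (intro incr) auto
    ultimately show "\<bar>z' x\<bar> \<le> J + e" by linarith
  qed
  from mean[OF t] obtain s where s: "0 < s" "s < t" "z t = t * z' s" by blast
  then show ?thesis using z'_le[of s] t unfolding J_def[symmetric] by (simp add: abs_mult)
qed

section \<open>Uniqueness of solutions\<close>

lemma bagley_torvik_solutionD:
  assumes "bagley_torvik_solution a b c f y0 y1 y"
  shows "y 0 = y0" "(y has_real_derivative y1) (at 0 within {0..})"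
    and "t > 0 \<Longrightarrow> (y has_real_derivative deriv y t) (at t)"
    and "t > 0 \<Longrightarrow> (deriv y has_real_derivative deriv (deriv y) t) (at t)"
    and "t > 0 \<Longrightarrow> set_integrable lborel {0<..<t} (\<lambda>\<tau>. deriv (deriv y) \<tau> / (t - \<tau>) powr (1/2))"
    and "t > 0 \<Longrightarrow> a * deriv (deriv y) t + b * caputo_three_halves y t + c * y t = f t"
  using assms unfolding bagley_torvik_solution_def
  by (auto simp: DERIV_deriv_iff_real_differentiable)

text \<open>
  Apply \<open>half_conv_inequality_imp_zero\<close> to the second derivative \<open>w\<close> of the difference \<open>z\<close>.  The term \<open>c z\<close>
  is bounded by the integral of \<open>|w|\<close>, hence also by a multiple of its half integral.
\<close>

lemma bagley_torvik_solution_unique: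
  assumes y: "bagley_torvik_solution a b c f y0 y1 y" and x: "bagley_torvik_solution a b c f y0 y1 x"
    and a: "a \<noteq> 0" and t: "t > 0"
  shows "y t = x t"
proof -
  note yD = bagley_torvik_solutionD[OF y] and xD = bagley_torvik_solutionD[OF x]
  define z where "z s = y s - x s" for s
  define z' where "z' s = deriv y s - deriv x s" for s
  define w where "w s = deriv (deriv y) s - deriv (deriv x) s" for s
  have int: "set_integrable lborel {0<..<s} (\<lambda>\<tau>. w \<tau> / (s - \<tau>) powr (1/2))" if "s > 0" for s
    using set_integral_diff(1)[OF yD(5)[OF that] xD(5)[OF that]] by (simp add: w_def diff_divide_distrib)
  have zb: "\<bar>z s\<bar> \<le> s * (LINT \<tau>:{0<..<s}|lborel. \<bar>w \<tau>\<bar>)" if s: "s > 0" for s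
  proof (rule bound_by_second_derivative[where z' = z'])
    show "z 0 = 0" by (simp add: z_def yD xD)
    show "(z has_real_derivative 0) (at 0 within {0..})"
      using DERIV_diff[OF yD(2) xD(2)] by (simp add: z_def[abs_def])
    show "set_integrable lborel {0<..<s} w" by (rule set_integrable_half_kernel(1)[OF int[OF s]])
  qed (auto simp: z_def[abs_def] z'_def[abs_def] w_def intro!: DERIV_diff yD xD s)
  define T where "T = t + 1"
  have T: "T > 0" using t by (simp add: T_def)
  have G: "Gamma (1/2 :: real) > 0" by (rule Gamma_real_pos) simp
  \<comment> \<open>The summand \<open>1\<close> only serves to make \<open>M\<close> positive.\<close>
  define M where "M = (\<bar>b\<bar> / Gamma (1/2) + \<bar>c\<bar> * (T * T powr (1/2))) / \<bar>a\<bar> + 1"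
  have M: "M > 0" using T G by (simp add: M_def add_nonneg_pos)
  have le: "ennreal \<bar>w s\<bar> \<le> ennreal M * half_conv w s" if s: "0 < s" "s < T" for s
  proof (cases "half_conv w s")
    case (real H)
    define K where "K = (LINT \<tau>:{0<..<s}|lborel. w \<tau> / (s - \<tau>) powr (1/2))"
    define J where "J = (LINT \<tau>:{0<..<s}|lborel. \<bar>w \<tau>\<bar>)"
    have KH: "\<bar>K\<bar> \<le> H"
      using set_integrable_half_kernel(3)[OF int[OF s(1)]] real by (simp add: K_def)
    have "J \<le> s powr (1/2) * H"
      using set_integrable_half_kernel(2)[OF int[OF s(1)]] real by (simp add: J_def flip: ennreal_mult)
    also have "\<dots> \<le> T powr (1/2) * H" using s real by (intro mult_right_mono powr_mono2) auto
    finally have J: "J \<le> T powr (1/2) * H" .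
    have "\<bar>z s\<bar> \<le> s * J" unfolding J_def by (rule zb[OF s(1)])
    also have "\<dots> \<le> s * (T powr (1/2) * H)" using s J by (intro mult_left_mono) auto
    also have "\<dots> \<le> T * (T powr (1/2) * H)" using s real by (intro mult_right_mono) auto
    finally have zH: "\<bar>z s\<bar> \<le> T * T powr (1/2) * H" by simp
    define Ky Kx where "Ky = (LINT \<tau>:{0<..<s}|lborel. deriv (deriv y) \<tau> / (s - \<tau>) powr (1/2))"
      and "Kx = (LINT \<tau>:{0<..<s}|lborel. deriv (deriv x) \<tau> / (s - \<tau>) powr (1/2))"
    have K: "K = Ky - Kx"
      unfolding K_def Ky_def Kx_def w_def diff_divide_distrib
      by (rule set_integral_diff(2)[OF yD(5)[OF s(1)] xD(5)[OF s(1)]])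
    have "a * deriv (deriv y) s + b / Gamma (1/2) * Ky + c * y s = f s"
         "a * deriv (deriv x) s + b / Gamma (1/2) * Kx + c * x s = f s"
      using yD(6)[OF s(1)] xD(6)[OF s(1)] by (simp_all add: Ky_def Kx_def caputo_three_halves_def)
    then have "a * w s + b / Gamma (1/2) * K + c * z s = 0"
      unfolding w_def z_def K right_diff_distrib by linarith
    then have "a * w s = - (b / Gamma (1/2) * K + c * z s)" by linarith
    then have "\<bar>a\<bar> * \<bar>w s\<bar> = \<bar>b / Gamma (1/2) * K + c * z s\<bar>" by (metis abs_minus_cancel abs_mult)
    also have "\<dots> \<le> \<bar>b\<bar> / Gamma (1/2) * \<bar>K\<bar> + \<bar>c\<bar> * \<bar>z s\<bar>"
      using G abs_triangle_ineq[of "b / Gamma (1/2) * K" "c * z s"] by (simp add: abs_mult)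
    also have "\<dots> \<le> \<bar>b\<bar> / Gamma (1/2) * H + \<bar>c\<bar> * (T * T powr (1/2) * H)"
      using KH zH G by (intro add_mono mult_left_mono) auto
    also have "\<dots> = (\<bar>b\<bar> / Gamma (1/2) + \<bar>c\<bar> * (T * T powr (1/2))) * H" by (simp add: algebra_simps)
    finally have "\<bar>w s\<bar> \<le> (\<bar>b\<bar> / Gamma (1/2) + \<bar>c\<bar> * (T * T powr (1/2))) / \<bar>a\<bar> * H"
      using a by (simp add: pos_le_divide_eq mult.commute)
    also have "\<dots> \<le> M * H" using real by (intro mult_right_mono) (auto simp: M_def)
    finally show ?thesis using real M by (simp add: ennreal_leI flip: ennreal_mult)
  qed (use M in \<open>simp add: ennreal_mult_top\<close>)
  \<comment> \<open>Only the restriction of \<open>w\<close> is known to be measurable.\<close>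
  define v where "v \<tau> = indicator {0<..<T} \<tau> * w \<tau>" for \<tau>
  have wint: "set_integrable lborel {0<..<T} w" by (rule set_integrable_half_kernel(1)[OF int[OF T]])
  have "AE s in lborel. s \<in> {0<..<T} \<longrightarrow> v s = 0"
  proof (rule half_conv_inequality_imp_zero[OF _ _ _ M])
    show "set_integrable lborel {0<..<T} v"
    proof -
      have "(\<lambda>\<tau>. indicator {0<..<T} \<tau> *\<^sub>R v \<tau>) = (\<lambda>\<tau>. indicator {0<..<T} \<tau> *\<^sub>R w \<tau>)"
        by (auto simp: v_def indicator_def)
      then show ?thesis using wint unfolding set_integrable_def by (simp only:)
    qed
    show "v \<in> borel_measurable borel"
      using wint by (simp add: set_integrable_def v_def[abs_def] borel_measurable_integrable)
    fix s assume s: "0 < s" "s < T"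
    have "half_conv v s = half_conv w s" using s by (intro half_conv_cong) (auto simp: v_def)
    then show "ennreal \<bar>v s\<bar> \<le> ennreal M * half_conv v s" using le[OF s] s by (simp add: v_def)
  qed
  then have "AE s in lborel. indicator {0<..<t} s *\<^sub>R \<bar>w s\<bar> = 0"
    by eventually_elim (auto simp: v_def T_def indicator_def)
  then have "(LINT \<tau>:{0<..<t}|lborel. \<bar>w \<tau>\<bar>) = 0"
    unfolding set_lebesgue_integral_def by (rule integral_eq_zero_AE)
  then show ?thesis using zb[OF t] by (simp add: z_def)
qed

text \<open>
  The three terms on the left of the equation are integrable on \<open>(0, 1)\<close>: \<open>y''\<close> by
  \<open>set_integrable_half_kernel\<close>, its half integral by \<open>half_conv_weighted\<close> with \<open>\<mu> = 1\<close>, and \<open>y\<close> because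
  it is bounded.
\<close>

lemma bagley_torvik_solution_rhs_integrable:
  assumes y: "bagley_torvik_solution a b c f y0 y1 y"
  shows "(\<integral>\<^sup>+t. ennreal (indicator {0<..<1} t * \<bar>f t\<bar>) \<partial>lborel) < \<infinity>"
proof -
  note yD = bagley_torvik_solutionD[OF y]
  define u where "u = deriv (deriv y)"
  define v where "v \<tau> = indicator {0<..<1} \<tau> * u \<tau>" for \<tau>
  have uint: "set_integrable lborel {0<..<1} u"
    unfolding u_def by (rule set_integrable_half_kernel(1)[OF yD(5)]) simp
  then have v: "integrable lborel v" by (simp add: set_integrable_def v_def[abs_def])
  then have [measurable]: "v \<in> borel_measurable borel" by simp
  have G: "Gamma (1/2 :: real) > 0" by (rule Gamma_real_pos) simp
  have cont: "continuous_on {0..1} y"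
  proof (unfold continuous_on_eq_continuous_within, intro ballI)
    fix s :: real assume s: "s \<in> {0..1}"
    show "continuous (at s within {0..1}) y"
    proof (cases "s = 0")
      case True
      have "continuous (at 0 within {0..}) y" using yD(2) by (rule DERIV_continuous)
      then show ?thesis unfolding True by (rule continuous_within_subset) auto
    next
      case False
      then show ?thesis using s yD(3)[of s] by (auto intro: continuous_at_imp_continuous_at_within DERIV_isCont)
    qed
  qed
  then have "bounded (y ` {0..1})" by (intro compact_imp_bounded compact_continuous_image) auto
  then obtain Y where "\<forall>x\<in>y ` {0..1}. norm x \<le> Y" unfolding bounded_iff by auto
  then have Y: "\<And>t. t \<in> {0..1} \<Longrightarrow> \<bar>y t\<bar> \<le> Y" by auto
  have Y0: "Y \<ge> 0" using Y[of 0] by simp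
  have "ennreal (indicator {0<..<1} t * \<bar>f t\<bar>) \<le> ennreal \<bar>a\<bar> * ennreal \<bar>v t\<bar>
     + ennreal (\<bar>b\<bar> / Gamma (1/2) * exp 1) * (ennreal (indicator {0<..<1} t * exp (- 1 * t)) * half_conv v t)
     + ennreal (\<bar>c\<bar> * Y) * indicator {0<..<1} t" for t
  proof (cases "t \<in> {0<..<1}")
    case True
    define K where "K = (LINT \<tau>:{0<..<t}|lborel. u \<tau> / (t - \<tau>) powr (1/2))"
    have "\<bar>f t\<bar> = \<bar>a * u t + b / Gamma (1/2) * K + c * y t\<bar>"
      using yD(6)[of t] True by (simp add: u_def K_def caputo_three_halves_def)
    also have "\<dots> \<le> \<bar>a\<bar> * \<bar>u t\<bar> + \<bar>b\<bar> / Gamma (1/2) * \<bar>K\<bar> + \<bar>c\<bar> * \<bar>y t\<bar>"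
      using G abs_triangle_ineq[of "a * u t + b / Gamma (1/2) * K" "c * y t"]
        abs_triangle_ineq[of "a * u t" "b / Gamma (1/2) * K"] by (simp add: abs_mult)
    also have "\<dots> \<le> \<bar>a\<bar> * \<bar>u t\<bar> + \<bar>b\<bar> / Gamma (1/2) * \<bar>K\<bar> + \<bar>c\<bar> * Y"
      using Y[of t] True by (intro add_left_mono mult_left_mono) auto
    finally have "ennreal \<bar>f t\<bar> \<le> ennreal (\<bar>a\<bar> * \<bar>u t\<bar> + \<bar>b\<bar> / Gamma (1/2) * \<bar>K\<bar> + \<bar>c\<bar> * Y)" by (rule ennreal_leI)
    also have "\<dots> = ennreal \<bar>a\<bar> * ennreal \<bar>u t\<bar> + ennreal (\<bar>b\<bar> / Gamma (1/2)) * ennreal \<bar>K\<bar> + ennreal (\<bar>c\<bar> * Y)"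
      using G Y0 by (simp add: ennreal_mult ennreal_plus[symmetric] del: ennreal_plus flip: ennreal_mult)
    finally have 1: "ennreal \<bar>f t\<bar> \<le> ennreal \<bar>a\<bar> * ennreal \<bar>u t\<bar> + ennreal (\<bar>b\<bar> / Gamma (1/2)) * ennreal \<bar>K\<bar> + ennreal (\<bar>c\<bar> * Y)" .
    have hv: "half_conv v t = half_conv u t" using True by (intro half_conv_cong) (auto simp: v_def)
    have "ennreal \<bar>K\<bar> \<le> half_conv u t"
      unfolding K_def u_def using True by (intro set_integrable_half_kernel(3) yD(5)) simp
    also have "\<dots> \<le> ennreal (exp 1 * exp (- 1 * t)) * half_conv u t"
    proof -
      have "1 \<le> ennreal (exp 1 * exp (- 1 * t))"
        using True by (simp add: exp_add[symmetric] ennreal_leI flip: ennreal_1 exp_add)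
      then show ?thesis using mult_right_mono[of 1 _ "half_conv u t"] by fastforce
    qed
    finally have "ennreal (\<bar>b\<bar> / Gamma (1/2)) * ennreal \<bar>K\<bar> \<le> ennreal (\<bar>b\<bar> / Gamma (1/2)) * (ennreal (exp 1 * exp (- 1 * t)) * half_conv u t)"
      by (intro mult_left_mono) auto
    also have "\<dots> = ennreal (\<bar>b\<bar> / Gamma (1/2) * exp 1) * (ennreal (exp (- 1 * t)) * half_conv u t)"
    proof -
      have "ennreal (\<bar>b\<bar> / Gamma (1/2) * exp 1) = ennreal (\<bar>b\<bar> / Gamma (1/2)) * ennreal (exp 1)"
        "ennreal (exp 1 * exp (- 1 * t)) = ennreal (exp 1) * ennreal (exp (- 1 * t))"
        using G by (intro ennreal_mult; simp)+
      then show ?thesis by (simp only: mult_ac)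
    qed
    finally have "ennreal \<bar>f t\<bar> \<le> ennreal \<bar>a\<bar> * ennreal \<bar>u t\<bar> + ennreal (\<bar>b\<bar> / Gamma (1/2) * exp 1) * (ennreal (exp (- 1 * t)) * half_conv u t) + ennreal (\<bar>c\<bar> * Y)"
      using order_trans[OF 1] by (meson add_left_mono add_right_mono)
    then show ?thesis using True by (simp add: hv v_def)
  qed simp
  then have "(\<integral>\<^sup>+t. ennreal (indicator {0<..<1} t * \<bar>f t\<bar>) \<partial>lborel) \<le>
    (\<integral>\<^sup>+t. ennreal \<bar>a\<bar> * ennreal \<bar>v t\<bar>
     + ennreal (\<bar>b\<bar> / Gamma (1/2) * exp 1) * (ennreal (indicator {0<..<1} t * exp (- 1 * t)) * half_conv v t)
     + ennreal (\<bar>c\<bar> * Y) * indicator {0<..<1} t \<partial>lborel)" by (rule nn_integral_mono)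
  also have "\<dots> = ennreal \<bar>a\<bar> * (\<integral>\<^sup>+t. ennreal \<bar>v t\<bar> \<partial>lborel)
     + ennreal (\<bar>b\<bar> / Gamma (1/2) * exp 1) * (\<integral>\<^sup>+t. ennreal (indicator {0<..<1} t * exp (- 1 * t)) * half_conv v t \<partial>lborel)
     + ennreal (\<bar>c\<bar> * Y) * emeasure lborel {0<..<1::real}"
    by (simp add: nn_integral_add nn_integral_cmult nn_integral_cmult_indicator)
  also have "\<dots> < \<infinity>"
  proof -
    have fin: "(\<integral>\<^sup>+t. ennreal \<bar>v t\<bar> \<partial>lborel) < \<infinity>" using v by (simp add: integrable_iff_bounded)
    have "(\<integral>\<^sup>+t. ennreal (indicator {0<..<1} t * exp (- 1 * t)) * half_conv v t \<partial>lborel)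
      \<le> ennreal (Gamma (1/2) / sqrt 1) * (\<integral>\<^sup>+t. ennreal (indicator {0<..<1} t * exp (- 1 * t) * \<bar>v t\<bar>) \<partial>lborel)"
      by (rule half_conv_weighted) auto
    also have "\<dots> \<le> ennreal (Gamma (1/2) / sqrt 1) * (\<integral>\<^sup>+t. ennreal \<bar>v t\<bar> \<partial>lborel)"
      by (intro mult_left_mono nn_integral_mono ennreal_leI) (auto simp: indicator_def mult_left_le_one_le)
    also have "\<dots> < \<infinity>" using fin by (simp add: ennreal_mult_less_top)
    finally show ?thesis using fin by (simp add: ennreal_mult_less_top)
  qed
  finally show ?thesis .
qed

section \<open>Construction of solutions\<close>

lemma bagley_torvik_solutionI:
  assumes "y 0 = y0" "(y has_real_derivative y1) (at 0 within {0..})"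
    and y': "\<And>t. t > 0 \<Longrightarrow> (y has_real_derivative y' t) (at t)"
    and u: "\<And>t. t > 0 \<Longrightarrow> (y' has_real_derivative u t) (at t)"
    and int: "\<And>t. t > 0 \<Longrightarrow> set_integrable lborel {0<..<t} (\<lambda>\<tau>. u \<tau> / (t - \<tau>) powr (1/2))"
    and eq: "\<And>t. t > 0 \<Longrightarrow> a * u t + b * (1 / Gamma (1/2) * (LINT \<tau>:{0<..<t}|lborel. u \<tau> / (t - \<tau>) powr (1/2))) + c * y t = f t"
  shows "bagley_torvik_solution a b c f y0 y1 y"
proof -
  have dy: "deriv y t = y' t" if "t > 0" for t using y'[OF that] by (rule DERIV_imp_deriv)
  have ddy': "(deriv y has_real_derivative u t) (at t)" if "t > 0" for t
    by (rule has_field_derivative_transform_within_open[OF u[OF that], of "{0<..}"]) (use that dy in auto)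
  have ddy: "deriv (deriv y) t = u t" if "t > 0" for t using ddy'[OF that] by (rule DERIV_imp_deriv)
  have "set_integrable lborel {0<..<t} (\<lambda>\<tau>. deriv (deriv y) \<tau> / (t - \<tau>) powr (1/2))" if "t > 0" for t
    using int[OF that] ddy by (subst set_integrable_cong[OF refl refl]) auto
  moreover have "a * deriv (deriv y) t + b * caputo_three_halves y t + c * y t = f t" if "t > 0" for t
  proof -
    have "(LINT \<tau>:{0<..<t}|lborel. deriv (deriv y) \<tau> / (t - \<tau>) powr (1/2)) =
        (LINT \<tau>:{0<..<t}|lborel. u \<tau> / (t - \<tau>) powr (1/2))"
      using ddy by (intro set_lebesgue_integral_cong) auto
    then show ?thesis using eq[OF that] ddy[OF that] by (simp add: caputo_three_halves_def)
  qed
  ultimately show ?thesis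
    unfolding bagley_torvik_solution_def real_differentiable_def using assms(1,2) y' ddy' by blast
qed

lemma bagley_torvik_solution_cong:
  assumes "bagley_torvik_solution a b c f y0 y1 y" "\<And>t. t > 0 \<Longrightarrow> f t = g t"
  shows "bagley_torvik_solution a b c g y0 y1 y"
  using assms unfolding bagley_torvik_solution_def by auto

lemma bagley_torvik_solution_add:
  assumes y: "bagley_torvik_solution a b c f y0 y1 y" and x: "bagley_torvik_solution a b c g x0 x1 x"
  shows "bagley_torvik_solution a b c (\<lambda>t. f t + g t) (y0 + x0) (y1 + x1) (\<lambda>t. y t + x t)"
proof -
  note yD = bagley_torvik_solutionD[OF y] and xD = bagley_torvik_solutionD[OF x]
  show ?thesis
  proof (rule bagley_torvik_solutionI)
    show "y 0 + x 0 = y0 + x0" by (simp add: yD xD)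
    show "((\<lambda>t. y t + x t) has_real_derivative y1 + x1) (at 0 within {0..})" by (intro DERIV_add yD xD)
    fix t :: real assume t: "t > 0"
    show "((\<lambda>t. y t + x t) has_real_derivative deriv y t + deriv x t) (at t)" by (intro DERIV_add yD xD t)
    show "((\<lambda>t. deriv y t + deriv x t) has_real_derivative deriv (deriv y) t + deriv (deriv x) t) (at t)"
      by (intro DERIV_add yD xD t)
    show "set_integrable lborel {0<..<t} (\<lambda>\<tau>. (deriv (deriv y) \<tau> + deriv (deriv x) \<tau>) / (t - \<tau>) powr (1/2))"
      unfolding add_divide_distrib by (intro set_integral_add yD xD t)
    show "a * (deriv (deriv y) t + deriv (deriv x) t) + b * (1 / Gamma (1/2) *
        (LINT \<tau>:{0<..<t}|lborel. (deriv (deriv y) \<tau> + deriv (deriv x) \<tau>) / (t - \<tau>) powr (1/2))) + c * (y t + x t) = f t + g t"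
      unfolding add_divide_distrib set_integral_add(2)[OF yD(5)[OF t] xD(5)[OF t]]
      using yD(6)[OF t] xD(6)[OF t] by (simp add: caputo_three_halves_def algebra_simps)
  qed
qed

lemma bagley_torvik_solution_cmult:
  assumes y: "bagley_torvik_solution a b c f y0 y1 y"
  shows "bagley_torvik_solution a b c (\<lambda>t. k * f t) (k * y0) (k * y1) (\<lambda>t. k * y t)"
proof -
  note yD = bagley_torvik_solutionD[OF y]
  show ?thesis
  proof (rule bagley_torvik_solutionI)
    show "k * y 0 = k * y0" by (simp add: yD)
    show "((\<lambda>t. k * y t) has_real_derivative k * y1) (at 0 within {0..})" by (intro DERIV_cmult yD)
    fix t :: real assume t: "t > 0"
    show "((\<lambda>t. k * y t) has_real_derivative k * deriv y t) (at t)" by (intro DERIV_cmult yD t)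
    show "((\<lambda>t. k * deriv y t) has_real_derivative k * deriv (deriv y) t) (at t)"
      by (intro DERIV_cmult yD t)
    show "set_integrable lborel {0<..<t} (\<lambda>\<tau>. k * deriv (deriv y) \<tau> / (t - \<tau>) powr (1/2))"
      unfolding times_divide_eq_right[symmetric] by (intro set_integrable_mult_right yD t)
    show "a * (k * deriv (deriv y) t) + b * (1 / Gamma (1/2) *
        (LINT \<tau>:{0<..<t}|lborel. k * deriv (deriv y) \<tau> / (t - \<tau>) powr (1/2))) + c * (k * y t) = k * f t"
      unfolding times_divide_eq_right[symmetric] set_integral_mult_right
      using arg_cong[OF yD(6)[OF t], of "(*) k"] by (simp add: caputo_three_halves_def algebra_simps)
  qed
qed

text \<open>
  The second derivative vanishes.  These solutions carry the initial values; the source \<open>c (y0 + y1 t)\<close>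
  is compensated by two power sources.
\<close>

lemma bagley_torvik_solution_affine:
  "bagley_torvik_solution a b c (\<lambda>t. c * (y0 + y1 * t)) y0 y1 (\<lambda>t. y0 + y1 * t)"
  by (rule bagley_torvik_solutionI[where y' = "\<lambda>_. y1" and u = "\<lambda>_. 0"])
     (auto intro!: derivative_eq_intros simp: set_integrable_def set_lebesgue_integral_def)

lemma bagley_torvik_solution_sum:
  assumes "finite A" "\<And>i. i \<in> A \<Longrightarrow> bagley_torvik_solution a b c (f i) 0 0 (y i)"
  shows "bagley_torvik_solution a b c (\<lambda>t. \<Sum>i\<in>A. f i t) 0 0 (\<lambda>t. \<Sum>i\<in>A. y i t)"
  using assms
proof (induction A rule: finite_induct)
  case empty
  then show ?case using bagley_torvik_solution_affine[of a b c 0 0] by simp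
next
  case (insert i A)
  then show ?case using bagley_torvik_solution_add[of a b c "f i" 0 0 "y i" "\<lambda>t. \<Sum>i\<in>A. f i t" 0 0] by simp
qed

lemma geom_bounded_add:
  assumes "geom_bounded u" "geom_bounded v"
  shows "geom_bounded (\<lambda>j. u j + v j)"
proof -
  from assms obtain K \<rho> K' \<rho>' where K: "K \<ge> 0" "\<rho> \<ge> 0" "\<And>j. \<bar>u j\<bar> \<le> K * \<rho> ^ j"
    and K': "K' \<ge> 0" "\<rho>' \<ge> 0" "\<And>j. \<bar>v j\<bar> \<le> K' * \<rho>' ^ j"
    unfolding geom_bounded_def by auto
  have "\<bar>u j + v j\<bar> \<le> (K + K') * max \<rho> \<rho>' ^ j" for j
  proof -
    have "\<bar>u j + v j\<bar> \<le> K * \<rho> ^ j + K' * \<rho>' ^ j" using K(3)[of j] K'(3)[of j] by linarith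
    also have "\<dots> \<le> K * max \<rho> \<rho>' ^ j + K' * max \<rho> \<rho>' ^ j"
      using K K' by (intro add_mono mult_left_mono power_mono) auto
    finally show ?thesis by (simp add: distrib_right)
  qed
  moreover have "K + K' \<ge> 0" "max \<rho> \<rho>' \<ge> 0" using K K' by auto
  ultimately show ?thesis unfolding geom_bounded_def by blast
qed

lemma frac_series_unfold3:
  assumes "geom_bounded h" "t > 0"
  shows "frac_series h \<beta> t = h 0 * rGamma (\<beta> + 1) * t powr \<beta> + h 1 * rGamma (\<beta> + 3/2) * t powr (\<beta> + 1/2)
    + h 2 * rGamma (\<beta> + 2) * t powr (\<beta> + 1) + frac_series (\<lambda>j. h (j + 3)) (\<beta> + 3/2) t"
  using frac_series_unfold[OF assms, of \<beta>]
    frac_series_unfold[OF geom_bounded_shift[OF assms(1), of 1] assms(2), of "\<beta> + 1/2"]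
    frac_series_unfold[OF geom_bounded_shift[OF assms(1), of 2] assms(2), of "\<beta> + 1"]
  by (simp add: add_ac numeral_2_eq_2 numeral_3_eq_3)

lemma frac_series_right_derivative_0:
  assumes h: "geom_bounded h" and \<beta>: "\<beta> > 1"
  shows "(frac_series h \<beta> has_real_derivative 0) (at 0 within {0..})"
proof -
  obtain A where A: "\<And>t. 0 < t \<Longrightarrow> t \<le> 1 \<Longrightarrow> \<bar>frac_series h \<beta> t\<bar> \<le> A * t powr \<beta>"
    using frac_series_bound[OF h] by blast
  have "((\<lambda>t. t powr (\<beta> - 1)) \<longlongrightarrow> 0 powr (\<beta> - 1)) (at 0 within {0..})"
    by (rule tendsto_powr'[OF tendsto_ident_at tendsto_const])
       (use \<beta> in \<open>auto simp: eventually_at_filter\<close>)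
  from tendsto_mult[OF tendsto_const this, of A]
  have lim: "((\<lambda>t. A * t powr (\<beta> - 1)) \<longlongrightarrow> 0) (at 0 within {0..})" by simp
  have "eventually (\<lambda>t. norm ((frac_series h \<beta> t - frac_series h \<beta> 0) / (t - 0)) \<le> A * t powr (\<beta> - 1)) (at 0 within {0..})"
    unfolding eventually_at
  proof (intro exI[of _ 1] conjI ballI impI)
    fix t :: real assume "t \<in> {0..}" "t \<noteq> 0 \<and> dist t 0 < 1"
    then have t: "0 < t" "t \<le> 1" by (auto simp: dist_real_def)
    have "\<bar>frac_series h \<beta> t\<bar> / t \<le> A * t powr \<beta> / t" using A[OF t] t by (intro divide_right_mono) auto
    then show "norm ((frac_series h \<beta> t - frac_series h \<beta> 0) / (t - 0)) \<le> A * t powr (\<beta> - 1)"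
      using t by (simp add: powr_diff)
  qed simp
  then show ?thesis
    unfolding has_field_derivative_iff by (rule Lim_null_comparison[OF _ lim])
qed

text \<open>
  A sequence with the properties of \<open>bt_moment_rec\<close>: apart from the growth condition they say that
  \<open>\<Sum>j. s (j + 3) X\<^sup>j\<close> is the inverse of \<open>a + b X + c X\<^sup>4\<close>.
\<close>

locale bt_coefficients =
  fixes a b c :: real and s :: "nat \<Rightarrow> real"
  assumes bounded: "geom_bounded s"
    and init: "s 0 = 0" "s 1 = 0" "s 2 = 0" "a * s 3 = 1"
    and rec: "a * s (j + 4) + b * s (j + 3) + c * s j = 0"
begin

lemma shift3:
  assumes "t > 0"
  shows "frac_series s \<beta> t = frac_series (\<lambda>j. s (j + 3)) (\<beta> + 3/2) t"
  using frac_series_unfold3[OF bounded assms, of \<beta>] init by simp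

text \<open>
  The three leading coefficients of \<open>s\<close> vanish, so with \<open>h j = s (j + 3)\<close> the solution starts with the
  power \<open>\<alpha> + 2\<close> and its second derivative with \<open>\<alpha>\<close>.  In the equation all coefficients cancel by the
  recursion, except for the leading one, which is \<open>a s 3 = 1\<close>.
\<close>

lemma power_source_solution:
  assumes \<alpha>: "\<alpha> > -1"
  shows "bagley_torvik_solution a b c (\<lambda>t. rGamma (\<alpha> + 1) * t powr \<alpha>) 0 0 (frac_series s (\<alpha> + 1/2))"
proof -
  define h where "h j = s (j + 3)" for j
  have h: "geom_bounded h" unfolding h_def by (rule geom_bounded_shift[OF bounded])
  have y_eq: "frac_series s (\<alpha> + 1/2) t = frac_series h (\<alpha> + 2) t" if "t > 0" for t
    using shift3[OF that, of "\<alpha> + 1/2"] by (simp add: h_def[abs_def] add.commute)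
  have u_eq: "frac_series s (\<alpha> - 3/2) t = frac_series h \<alpha> t" if "t > 0" for t
    using shift3[OF that, of "\<alpha> - 3/2"] by (simp add: h_def[abs_def])
  show ?thesis
  proof (rule bagley_torvik_solutionI)
    show "frac_series s (\<alpha> + 1/2) 0 = 0" by simp
    have "(frac_series h (\<alpha> + 2) has_real_derivative 0) (at 0 within {0..})"
      using \<alpha> by (intro frac_series_right_derivative_0 h) simp
    then show "(frac_series s (\<alpha> + 1/2) has_real_derivative 0) (at 0 within {0..})"
    proof (rule has_field_derivative_transform_within[OF _ zero_less_one])
      fix x :: real assume "x \<in> {0..}"
      then show "frac_series h (\<alpha> + 2) x = frac_series s (\<alpha> + 1/2) x"
        using y_eq[of x] by (cases "x = 0") auto
    qed simp
    fix t :: real assume t: "t > 0"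
    show "(frac_series s (\<alpha> + 1/2) has_real_derivative frac_series s (\<alpha> - 1/2) t) (at t)"
      using frac_series_has_derivative[OF bounded t, of "\<alpha> + 1/2"] by simp
    show "(frac_series s (\<alpha> - 1/2) has_real_derivative frac_series s (\<alpha> - 3/2) t) (at t)"
      using frac_series_has_derivative[OF bounded t, of "\<alpha> - 1/2"] by simp
    show "set_integrable lborel {0<..<t} (\<lambda>\<tau>. frac_series s (\<alpha> - 3/2) \<tau> / (t - \<tau>) powr (1/2))"
      using frac_series_half_integral(1)[OF h \<alpha> t] u_eq by (subst set_integrable_cong[OF refl refl]) auto
    have "(LINT \<tau>:{0<..<t}|lborel. frac_series s (\<alpha> - 3/2) \<tau> / (t - \<tau>) powr (1/2)) =
        (LINT \<tau>:{0<..<t}|lborel. frac_series h \<alpha> \<tau> / (t - \<tau>) powr (1/2))"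
      using u_eq by (intro set_lebesgue_integral_cong) auto
    also have "\<dots> = Gamma (1/2) * frac_series h (\<alpha> + 1/2) t" by (rule frac_series_half_integral(2)[OF h \<alpha> t])
    finally have D: "1 / Gamma (1/2) * (LINT \<tau>:{0<..<t}|lborel. frac_series s (\<alpha> - 3/2) \<tau> / (t - \<tau>) powr (1/2))
        = frac_series h (\<alpha> + 1/2) t"
      using less_imp_neq[OF Gamma_real_pos[of "1/2"]] by simp
    have h': "geom_bounded (\<lambda>j. h (Suc j))" using geom_bounded_shift[OF h, of 1] by simp
    have ah0: "a * h 0 = 1" using init by (simp add: h_def)
    have "a * frac_series h \<alpha> t + b * frac_series h (\<alpha> + 1/2) t + c * frac_series s (\<alpha> + 1/2) t
      = a * h 0 * rGamma (\<alpha> + 1) * t powr \<alpha> + (a * frac_series (\<lambda>j. h (Suc j)) (\<alpha> + 1/2) t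
        + b * frac_series h (\<alpha> + 1/2) t + c * frac_series s (\<alpha> + 1/2) t)"
      by (simp add: frac_series_unfold[OF h t, of \<alpha>] algebra_simps)
    also have "a * frac_series (\<lambda>j. h (Suc j)) (\<alpha> + 1/2) t + b * frac_series h (\<alpha> + 1/2) t + c * frac_series s (\<alpha> + 1/2) t
      = frac_series (\<lambda>j. a * h (Suc j) + b * h j + c * s j) (\<alpha> + 1/2) t"
      using h h' bounded t by (simp add: frac_series_add frac_series_cmult geom_bounded_cmult geom_bounded_add)
    also have "(\<lambda>j. a * h (Suc j) + b * h j + c * s j) = (\<lambda>j. 0)"
      using rec by (simp add: h_def fun_eq_iff eval_nat_numeral)
    finally show "a * frac_series s (\<alpha> - 3/2) t + b * (1 / Gamma (1/2) *
       (LINT \<tau>:{0<..<t}|lborel. frac_series s (\<alpha> - 3/2) \<tau> / (t - \<tau>) powr (1/2))) + c * frac_series s (\<alpha> + 1/2) t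
       = rGamma (\<alpha> + 1) * t powr \<alpha>"
      unfolding D u_eq[OF t] by (simp add: ah0)
  qed
qed

text \<open>
  The left side is what \<open>bt_complementary\<close> becomes when its Mittag-Leffler functions are expanded.  By the
  recursion its coefficients are \<open>y0\<close>, \<open>0\<close>, \<open>y1\<close>, followed by \<open>- c y0 s (j + 2) - c y1 s j\<close>.
\<close>

lemma homogeneous_series:
  assumes t: "t > 0"
  shows "frac_series (\<lambda>j. y0 * (a * s (j + 3) + b * s (j + 2)) + y1 * (a * s (j + 1) + b * s j)) 0 t
    = y0 + y1 * t - c * y0 * frac_series s (1/2) t - c * y1 * frac_series s (3/2) t"
proof -
  define q where "q j = y0 * (a * s (j + 3) + b * s (j + 2)) + y1 * (a * s (j + 1) + b * s j)" for j
  have q: "geom_bounded q"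
    unfolding q_def by (intro geom_bounded_cmult geom_bounded_add geom_bounded_shift bounded)
  have q0: "q 0 = y0" "q 1 = 0" "q 2 = y1"
    using init rec[of 0] rec[of 1] by (simp_all add: q_def numeral_eq_Suc)
  have qq: "a * s (j + 6) + b * s (j + 5) = - c * s (j + 2)" "a * s (j + 4) + b * s (j + 3) = - c * s j" for j
    using rec[of "j + 2"] rec[of j] by (simp_all add: add_ac eq_neg_iff_add_eq_0)
  have q3: "q (j + 3) = (- c * y0) * s (j + 2) + (- c * y1) * s j" for j
  proof -
    have idx: "j + 3 + 3 = j + 6" "j + 3 + 2 = j + 5" "j + 3 + 1 = j + 4" by simp_all
    show ?thesis unfolding q_def idx qq by (simp add: algebra_simps)
  qed
  have s2: "frac_series (\<lambda>j. s (j + 2)) (3/2) t = frac_series s (1/2) t"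
    using frac_series_unfold[OF bounded t, of "1/2"] init
      frac_series_unfold[OF geom_bounded_shift[OF bounded, of 1] t, of 1] by simp
  have "frac_series q 0 t = y0 + y1 * t + frac_series (\<lambda>j. q (j + 3)) (3/2) t"
    using frac_series_unfold3[OF q t, of 0] q0 t rGamma_plus1[of "1::real"] by simp
  also have "frac_series (\<lambda>j. q (j + 3)) (3/2) t = (- c * y0) * frac_series s (1/2) t + (- c * y1) * frac_series s (3/2) t"
    unfolding q3 s2[symmetric] using t
    by (simp only: frac_series_add frac_series_cmult geom_bounded_cmult geom_bounded_shift bounded)
  finally show ?thesis unfolding q_def by simp
qed

lemma explicit_solution:
  fixes C \<alpha> :: "nat \<Rightarrow> real"
  assumes A: "finite A" "\<And>l. l \<in> A \<Longrightarrow> \<alpha> l > -1"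
  shows "bagley_torvik_solution a b c (\<lambda>t. \<Sum>l\<in>A. C l * t powr \<alpha> l) y0 y1
     (\<lambda>t. (\<Sum>l\<in>A. C l * Gamma (\<alpha> l + 1) * frac_series s (\<alpha> l + 1/2) t)
        + (y0 + y1 * t - c * y0 * frac_series s (1/2) t - c * y1 * frac_series s (3/2) t))"
proof -
  have G: "Gamma (\<alpha> l + 1) * rGamma (\<alpha> l + 1) = 1" if "l \<in> A" for l
  proof -
    have "Gamma (\<alpha> l + 1) > 0" using A(2)[OF that] by (intro Gamma_real_pos) simp
    then show ?thesis unfolding rGamma_inverse_Gamma by (intro right_inverse) simp
  qed
  have 1: "bagley_torvik_solution a b c (\<lambda>t. \<Sum>l\<in>A. C l * Gamma (\<alpha> l + 1) * (rGamma (\<alpha> l + 1) * t powr \<alpha> l)) 0 0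
    (\<lambda>t. \<Sum>l\<in>A. C l * Gamma (\<alpha> l + 1) * frac_series s (\<alpha> l + 1/2) t)"
  proof (rule bagley_torvik_solution_sum[OF A(1)])
    fix l assume "l \<in> A"
    from bagley_torvik_solution_cmult[OF power_source_solution[OF A(2)[OF this]], of "C l * Gamma (\<alpha> l + 1)"]
    show "bagley_torvik_solution a b c (\<lambda>t. C l * Gamma (\<alpha> l + 1) * (rGamma (\<alpha> l + 1) * t powr \<alpha> l)) 0 0
      (\<lambda>t. C l * Gamma (\<alpha> l + 1) * frac_series s (\<alpha> l + 1/2) t)" by simp
  qed
  note 2 = bagley_torvik_solution_affine[of a b c y0 y1]
  have 3: "bagley_torvik_solution a b c (\<lambda>t. - c * y0 * (rGamma 1 * t powr 0)) 0 0 (\<lambda>t. - c * y0 * frac_series s (1/2) t)"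
    using bagley_torvik_solution_cmult[OF power_source_solution[of 0], of "- c * y0"] by simp
  have 4: "bagley_torvik_solution a b c (\<lambda>t. - c * y1 * (rGamma 2 * t powr 1)) 0 0 (\<lambda>t. - c * y1 * frac_series s (3/2) t)"
    using bagley_torvik_solution_cmult[OF power_source_solution[of 1], of "- c * y1"] by simp
  have "(rGamma 2 :: real) = 1" using rGamma_plus1[of "1::real"] by simp
  moreover have "(\<Sum>l\<in>A. C l * Gamma (\<alpha> l + 1) * (rGamma (\<alpha> l + 1) * t powr \<alpha> l)) = (\<Sum>l\<in>A. C l * t powr \<alpha> l)" for t
  proof (rule sum.cong[OF refl])
    fix l assume "l \<in> A"
    have "C l * Gamma (\<alpha> l + 1) * (rGamma (\<alpha> l + 1) * t powr \<alpha> l)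
        = C l * (Gamma (\<alpha> l + 1) * rGamma (\<alpha> l + 1)) * t powr \<alpha> l" by (simp only: mult.assoc)
    then show "C l * Gamma (\<alpha> l + 1) * (rGamma (\<alpha> l + 1) * t powr \<alpha> l) = C l * t powr \<alpha> l"
      using G[OF \<open>l \<in> A\<close>] by simp
  qed
  ultimately have "(\<Sum>l\<in>A. C l * Gamma (\<alpha> l + 1) * (rGamma (\<alpha> l + 1) * t powr \<alpha> l)) + (c * (y0 + y1 * t)
      + (- c * y0 * (rGamma 1 * t powr 0) + - c * y1 * (rGamma 2 * t powr 1))) = (\<Sum>l\<in>A. C l * t powr \<alpha> l)"
    if "t > 0" for t
    using that by (simp add: algebra_simps)
  from bagley_torvik_solution_cong[OF bagley_torvik_solution_add[OF 1 bagley_torvik_solution_add[OF 2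
      bagley_torvik_solution_add[OF 3 4]]] this]
  show ?thesis by (simp add: algebra_simps)
qed

end

section \<open>Sources that are not integrable at the origin\<close>

text \<open>
  Let \<open>m \<le> -1\<close> be the least exponent with nonzero coefficient.  Near \<open>0\<close> the sum is at least
  \<open>K t\<^sup>m \<ge> K / t\<close> in absolute value with \<open>K > 0\<close>, and the logarithm is unbounded at \<open>0\<close>.
\<close>

lemma power_sum_integrable_near_0:
  fixes D :: "real \<Rightarrow> real"
  assumes S: "finite S" and fin: "(\<integral>\<^sup>+t. ennreal (indicator {0<..<1} t * \<bar>\<Sum>x\<in>S. D x * t powr x\<bar>) \<partial>lborel) < \<infinity>"
    and x: "x \<in> S" "x \<le> -1"
  shows "D x = 0"
proof (rule ccontr)
  assume Dx: "D x \<noteq> 0"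
  define B where "B = {x \<in> S. D x \<noteq> 0}"
  define m where "m = Min B"
  have B: "finite B" "x \<in> B" using S x Dx by (auto simp: B_def)
  have m: "m \<in> B" "m \<le> -1"
    using Min_in[OF B(1)] order_trans[OF Min_le[OF B] x(2)] B(2) by (auto simp: m_def)
  define f where "f t = (\<Sum>x\<in>S. D x * t powr x)" for t
  define K where "K = \<bar>D m\<bar> / 2"
  have K: "K > 0" "K < \<bar>D m\<bar>" using m by (auto simp: K_def B_def)
  have fB: "f t = (\<Sum>x\<in>B. D x * t powr x)" for t
    unfolding f_def B_def using S by (intro sum.mono_neutral_right) auto
  have lim: "((\<lambda>t. \<Sum>x\<in>B. D x * t powr (x - m)) \<longlongrightarrow> (\<Sum>x\<in>B. if x = m then D m else 0)) (at_right 0)"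
  proof (intro tendsto_sum)
    fix x assume x: "x \<in> B"
    show "((\<lambda>t. D x * t powr (x - m)) \<longlongrightarrow> (if x = m then D m else 0)) (at_right 0)"
    proof (cases "x = m")
      case True
      have "((\<lambda>t. D m * t powr (m - m)) \<longlongrightarrow> D m) (at_right 0)"
        by (rule Lim_transform_eventually[OF tendsto_const]) (auto simp: eventually_at_filter)
      then show ?thesis unfolding True by simp
    next
      case False
      then have "x - m > 0" using Min_le[OF B(1) x] by (simp add: m_def)
      then have "((\<lambda>t. t powr (x - m)) \<longlongrightarrow> 0 powr (x - m)) (at_right (0::real))"
        by (intro tendsto_powr'[OF tendsto_ident_at tendsto_const]) (auto simp: eventually_at_filter)
      from tendsto_mult[OF tendsto_const this, of "D x"] show ?thesis using False by simp
    qed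
  qed
  have "(\<Sum>x\<in>B. if x = m then D m else 0) = D m" using B m by (simp add: sum.delta)
  with tendsto_rabs[OF lim] have "((\<lambda>t. \<bar>\<Sum>x\<in>B. D x * t powr (x - m)\<bar>) \<longlongrightarrow> \<bar>D m\<bar>) (at_right 0)" by simp
  from order_tendstoD(1)[OF this K(2)] obtain d0 where d0: "d0 > 0"
    "\<And>t. 0 < t \<Longrightarrow> t < d0 \<Longrightarrow> K < \<bar>\<Sum>x\<in>B. D x * t powr (x - m)\<bar>"
    unfolding eventually_at_right_field by auto
  define d where "d = min d0 1 / 2"
  have d: "d > 0" "d < d0" "d < 1" using d0 by (auto simp: d_def)
  have lower: "K / t \<le> \<bar>f t\<bar>" if t: "0 < t" "t \<le> d" for t
  proof -
    have "f t = t powr m * (\<Sum>x\<in>B. D x * t powr (x - m))"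
      unfolding fB sum_distrib_left using t by (intro sum.cong refl) (simp add: powr_diff)
    then have "\<bar>f t\<bar> = t powr m * \<bar>\<Sum>x\<in>B. D x * t powr (x - m)\<bar>" by (simp add: abs_mult)
    moreover have "1 / t \<le> t powr m"
      using powr_mono'[of m "-1" t] m t d by (simp add: powr_minus_divide)
    then have "1 / t * K \<le> t powr m * \<bar>\<Sum>x\<in>B. D x * t powr (x - m)\<bar>"
      using d0(2)[of t] t d K by (intro mult_mono) auto
    ultimately show ?thesis by (simp add: mult.commute)
  qed
  define I where "I = (\<integral>\<^sup>+t. ennreal (indicator {0<..<1} t * \<bar>f t\<bar>) \<partial>lborel)"
  have "I < \<infinity>" using fin by (simp add: I_def f_def)
  then obtain R where R: "I = ennreal R" "R \<ge> 0" by (cases I) auto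
  \<comment> \<open>Chosen such that the integral of \<open>K / t\<close> from \<open>e\<close> to \<open>d\<close> is \<open>R + 1\<close>, which exceeds \<open>I\<close>.\<close>
  define e where "e = d * exp (- ((R + 1) / K))"
  have "exp (- ((R + 1) / K)) \<le> 1" using R K by simp
  then have e: "0 < e" "e \<le> d" using d by (auto simp: e_def mult_left_le)
  have "ln e = ln d - (R + 1) / K" using d by (simp add: e_def ln_mult)
  then have "ennreal (R + 1) = ennreal (K * ln d - K * ln e)" using K by (simp add: right_diff_distrib)
  also have "\<dots> = (\<integral>\<^sup>+t. ennreal (K / t) * indicator {e..d} t \<partial>lborel)"
    using e K by (intro nn_integral_FTC_Icc[symmetric]) (auto intro!: derivative_eq_intros)
  also have "\<dots> \<le> I"
    unfolding I_def using lower e d by (intro nn_integral_mono) (auto simp: indicator_def intro!: ennreal_leI)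
  finally show False using R by (simp add: ennreal_le_iff)
qed

text \<open>
  Several indices may carry the same exponent, so only the total coefficient of each exponent is known to vanish.
  This suffices whenever the rest of the summand depends on the index through the exponent alone.
\<close>

lemma sum_group_vanish:
  fixes C \<alpha> :: "nat \<Rightarrow> real" and \<phi> :: "real \<Rightarrow> 'a :: real_field"
  assumes "finite I" "\<And>x. x \<in> \<alpha> ` I \<Longrightarrow> \<not> P x \<Longrightarrow> (\<Sum>l | l \<in> I \<and> \<alpha> l = x. C l) = 0"
  shows "(\<Sum>l\<in>I. of_real (C l) * \<phi> (\<alpha> l)) = (\<Sum>l | l \<in> I \<and> P (\<alpha> l). of_real (C l) * \<phi> (\<alpha> l))"
proof -
  define N where "N = {l \<in> I. \<not> P (\<alpha> l)}"
  have "(\<Sum>l\<in>N. of_real (C l) * \<phi> (\<alpha> l)) = (\<Sum>x\<in>\<alpha> ` N. \<Sum>l | l \<in> N \<and> \<alpha> l = x. of_real (C l) * \<phi> (\<alpha> l))"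
    using assms(1) by (intro sum.image_gen) (simp add: N_def)
  also have "\<dots> = 0"
  proof (rule sum.neutral, rule ballI)
    fix x assume "x \<in> \<alpha> ` N"
    then have x: "x \<in> \<alpha> ` I" "\<not> P x" by (auto simp: N_def)
    have "(\<Sum>l | l \<in> N \<and> \<alpha> l = x. of_real (C l) * \<phi> (\<alpha> l)) = of_real (\<Sum>l | l \<in> I \<and> \<alpha> l = x. C l) * \<phi> x"
      unfolding of_real_sum sum_distrib_right using x(2) by (intro sum.cong) (auto simp: N_def)
    then show "(\<Sum>l | l \<in> N \<and> \<alpha> l = x. of_real (C l) * \<phi> (\<alpha> l)) = 0" using assms(2)[OF x] by simp
  qed
  finally have "(\<Sum>l\<in>N. of_real (C l) * \<phi> (\<alpha> l)) = 0" .
  moreover have "(\<Sum>l\<in>I. of_real (C l) * \<phi> (\<alpha> l)) =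
      (\<Sum>l | l \<in> I \<and> P (\<alpha> l). of_real (C l) * \<phi> (\<alpha> l)) + (\<Sum>l\<in>N. of_real (C l) * \<phi> (\<alpha> l))"
    unfolding N_def using assms(1) by (subst sum.union_disjoint[symmetric]) (auto intro!: sum.cong)
  ultimately show ?thesis by simp
qed

section \<open>The solution formula\<close>

text \<open>
  The moments are real numbers (\<open>of_real_bt_coeff\<close>), although nonreal roots contribute to them.
\<close>

definition bt_coeff :: "real \<Rightarrow> real \<Rightarrow> real \<Rightarrow> nat \<Rightarrow> real" where
  "bt_coeff a b c j = Re (bt_moment a b c j)"

context
  fixes a b c :: real
  assumes card: "card {r. poly (bt_poly a b c) r = 0} = 4"
begin

lemma of_real_bt_coeff: "of_real (bt_coeff a b c j) = bt_moment a b c j"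
proof -
  note rec = bt_moment_rec[OF card]
  have a: "a \<noteq> 0" by (rule bt_poly_4_roots_nonzero[OF card])
  have "Im (bt_moment a b c j) = 0"
  proof (induction j rule: less_induct)
    case (less j)
    show ?case
    proof (cases "j < 4")
      case True
      have "bt_moment a b c 3 = of_real (1 / a)" using rec(4) a by (simp add: field_simps)
      moreover have "j = 0 \<or> j = 1 \<or> j = 2 \<or> j = 3" using True by auto
      ultimately show ?thesis using rec(1-3) by auto
    next
      case False
      then obtain i where i: "j = i + 4" by (metis add.commute le_Suc_ex not_less)
      have "a * Im (bt_moment a b c (i + 4)) + b * Im (bt_moment a b c (i + 3)) + c * Im (bt_moment a b c i) = 0"
        using arg_cong[OF rec(5)[of i], of Im] by simp
      then show ?thesis using less[of "i + 3"] less[of i] a unfolding i by simp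
    qed
  qed
  then show ?thesis by (simp add: bt_coeff_def complex_eq_iff)
qed

lemma geom_bounded_bt_coeff: "geom_bounded (bt_coeff a b c)"
proof -
  define r where "r = bt_root a b c"
  define d where "d k = 4 * of_real a * r k ^ 3 + 3 * of_real b * r k ^ 2" for k
  have "\<bar>bt_coeff a b c j\<bar> \<le> (\<Sum>k=1..4. 1 / norm (d k)) * (\<Sum>k=1..4. norm (r k)) ^ j" for j
  proof -
    have "\<bar>bt_coeff a b c j\<bar> \<le> norm (bt_moment a b c j)" unfolding bt_coeff_def by (rule abs_Re_le_cmod)
    also have "\<dots> \<le> (\<Sum>k=1..4. norm (r k ^ j / d k))"
      unfolding bt_moment_def r_def[symmetric] d_def[symmetric] by (rule norm_sum)
    also have "\<dots> \<le> (\<Sum>k=1..4. 1 / norm (d k) * (\<Sum>k=1..4. norm (r k)) ^ j)"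
    proof (rule sum_mono)
      fix k :: nat assume k: "k \<in> {1..4}"
      have "norm (r k) ^ j \<le> (\<Sum>k=1..4. norm (r k)) ^ j"
        using k by (intro power_mono member_le_sum) auto
      then have "1 / norm (d k) * norm (r k) ^ j \<le> 1 / norm (d k) * (\<Sum>k=1..4. norm (r k)) ^ j"
        by (intro mult_left_mono) auto
      then show "norm (r k ^ j / d k) \<le> 1 / norm (d k) * (\<Sum>k=1..4. norm (r k)) ^ j"
        by (simp add: norm_divide norm_power)
    qed
    finally show ?thesis by (simp only: sum_distrib_right)
  qed
  moreover have "(\<Sum>k=1..4. 1 / norm (d k)) \<ge> 0" "(\<Sum>k=1..4. norm (r k)) \<ge> 0" by (intro sum_nonneg; simp)+
  ultimately show ?thesis unfolding geom_bounded_def by blast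
qed

lemma bt_coefficients_bt_coeff: "bt_coefficients a b c (bt_coeff a b c)"
proof
  have *: "a * bt_coeff a b c (j + 4) + b * bt_coeff a b c (j + 3) + c * bt_coeff a b c j = 0" for j
    using arg_cong[OF bt_moment_rec(5)[OF card, of j], of Re] by (simp add: bt_coeff_def)
  then show "a * bt_coeff a b c (j + 4) + b * bt_coeff a b c (j + 3) + c * bt_coeff a b c j = 0" for j .
  show "bt_coeff a b c 0 = 0" "bt_coeff a b c 1 = 0" "bt_coeff a b c 2 = 0"
    using bt_moment_rec(1-3)[OF card] by (simp_all add: bt_coeff_def)
  show "a * bt_coeff a b c 3 = 1"
    using arg_cong[OF bt_moment_rec(4)[OF card], of Re] by (simp add: bt_coeff_def)
qed (rule geom_bounded_bt_coeff)

lemma bt_forced_eq_frac_series: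
  assumes t: "t > 0"
  shows "bt_forced a b c n C \<alpha> t =
    (\<Sum>l=0..n. of_real (C l) * of_real (Gamma (\<alpha> l + 1) * frac_series (bt_coeff a b c) (\<alpha> l + 1/2) t))"
proof -
  define A where "A k = 1 / (4 * of_real a * bt_root a b c k ^ 3 + 3 * of_real b * bt_root a b c k ^ 2)" for k
  have u: "of_real (bt_coeff a b c j) = (\<Sum>k=1..4. A k * bt_root a b c k ^ j)" for j
    unfolding of_real_bt_coeff bt_moment_def by (simp add: A_def)
  have "of_real (t powr (\<alpha> l + 1/2)) * (\<Sum>k=1..4. A k * mittag_leffler (1/2) (of_real (\<alpha> l + 1/2) + 1) (bt_root a b c k * of_real (sqrt t)))
    = of_real (frac_series (bt_coeff a b c) (\<alpha> l + 1/2) t)" for l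
    by (rule frac_series_eq_mittag_leffler_sum[OF geom_bounded_bt_coeff u t])
  moreover have "of_real (\<alpha> l + 1/2) + 1 = 3/2 + complex_of_real (\<alpha> l)" for l by simp
  ultimately have *: "of_real (t powr (1/2 + \<alpha> l)) * (\<Sum>k=1..4. A k * mittag_leffler (1/2) (3/2 + of_real (\<alpha> l)) (bt_root a b c k * of_real (sqrt t)))
    = of_real (frac_series (bt_coeff a b c) (\<alpha> l + 1/2) t)" for l
    by (simp only: add.commute)
  show ?thesis
    unfolding bt_forced_def Let_def
  proof (rule sum.cong[OF refl])
    fix l
    have "(\<Sum>k=1..4. mittag_leffler (1/2) (3/2 + of_real (\<alpha> l)) (bt_root a b c k * of_real (sqrt t)) /
        (4 * of_real a * bt_root a b c k ^ 3 + 3 * of_real b * (bt_root a b c k)\<^sup>2)) =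
      (\<Sum>k=1..4. A k * mittag_leffler (1/2) (3/2 + of_real (\<alpha> l)) (bt_root a b c k * of_real (sqrt t)))"
      by (simp add: A_def)
    then show "complex_of_real (C l * Gamma (\<alpha> l + 1) * t powr (1/2 + \<alpha> l)) *
       (\<Sum>k=1..4. mittag_leffler (1/2) (3/2 + of_real (\<alpha> l)) (bt_root a b c k * of_real (sqrt t)) /
        (4 * of_real a * bt_root a b c k ^ 3 + 3 * of_real b * (bt_root a b c k)\<^sup>2)) =
      of_real (C l) * of_real (Gamma (\<alpha> l + 1) * frac_series (bt_coeff a b c) (\<alpha> l + 1/2) t)"
      using *[of l] by (simp add: mult.assoc)
  qed
qed

lemma bt_complementary_eq_frac_series:
  assumes t: "t > 0"
  shows "bt_complementary a b c y0 y1 t = of_real (y0 + y1 * t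
    - c * y0 * frac_series (bt_coeff a b c) (1/2) t - c * y1 * frac_series (bt_coeff a b c) (3/2) t)"
proof -
  interpret bt_coefficients a b c "bt_coeff a b c" by (rule bt_coefficients_bt_coeff)
  define r where "r = bt_root a b c"
  define d where "d k = 4 * of_real a * r k ^ 3 + 3 * of_real b * r k ^ 2" for k
  define A where "A k = (of_real a * r k + of_real b) * ((r k)\<^sup>2 * of_real y0 + of_real y1) / d k" for k
  define q where "q j = y0 * (a * bt_coeff a b c (j + 3) + b * bt_coeff a b c (j + 2)) +
    y1 * (a * bt_coeff a b c (j + 1) + b * bt_coeff a b c j)" for j
  have q: "geom_bounded q"
    unfolding q_def by (intro geom_bounded_cmult geom_bounded_add geom_bounded_shift bounded)
  have "of_real (q j) = (\<Sum>k=1..4. A k * r k ^ j)" for j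
  proof -
    have "of_real (q j) = (\<Sum>k=1..4. of_real y0 * (of_real a * (r k ^ (j + 3) / d k) + of_real b * (r k ^ (j + 2) / d k))
      + of_real y1 * (of_real a * (r k ^ (j + 1) / d k) + of_real b * (r k ^ j / d k)))"
      unfolding q_def of_real_add of_real_mult of_real_bt_coeff bt_moment_def r_def[symmetric] d_def[symmetric]
      by (simp only: sum.distrib sum_distrib_left[symmetric])
    also have "\<dots> = (\<Sum>k=1..4. A k * r k ^ j)"
    proof (rule sum.cong[OF refl])
      fix k
      have "y * (p * (x ^ (j + 3) / e) + s * (x ^ (j + 2) / e)) + z * (p * (x ^ (j + 1) / e) + s * (x ^ j / e)) =
        (p * x + s) * (x\<^sup>2 * y + z) / e * x ^ j" for x y z p s e :: complex
        by (cases "e = 0") (simp_all add: power_add power2_eq_square power3_eq_cube field_simps)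
      then show "of_real y0 * (of_real a * (r k ^ (j + 3) / d k) + of_real b * (r k ^ (j + 2) / d k))
        + of_real y1 * (of_real a * (r k ^ (j + 1) / d k) + of_real b * (r k ^ j / d k)) = A k * r k ^ j"
        unfolding A_def .
    qed
    finally show ?thesis .
  qed
  from frac_series_eq_mittag_leffler_sum[OF q this t, of 0]
  have "of_real (frac_series q 0 t) = (\<Sum>k=1..4. A k * mittag_leffler (1/2) 1 (r k * of_real (sqrt t)))"
    using t by simp
  also have "\<dots> = bt_complementary a b c y0 y1 t"
    unfolding bt_complementary_def Let_def r_def[symmetric]
  proof (rule sum.cong[OF refl])
    fix k
    have "(r k * of_real (sqrt t))\<^sup>2 = (r k)\<^sup>2 * complex_of_real t"
      using t by (simp add: power_mult_distrib flip: of_real_power)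
    then have "mittag_leffler (1/2) 1 (r k * of_real (sqrt t)) = exp ((r k)\<^sup>2 * of_real t) * erfc (- r k * of_real (sqrt t))"
      using exp_erfc_eq_mittag_leffler[of "r k * of_real (sqrt t)"] by simp
    moreover have "d k = (4 * of_real a * r k + 3 * of_real b) * (r k)\<^sup>2"
      by (simp add: d_def power2_eq_square power3_eq_cube algebra_simps)
    ultimately show "A k * mittag_leffler (1/2) 1 (r k * of_real (sqrt t)) =
      (of_real a * r k + of_real b) * ((r k)\<^sup>2 * of_real y0 + of_real y1) /
      ((4 * of_real a * r k + 3 * of_real b) * (r k)\<^sup>2) * exp ((r k)\<^sup>2 * of_real t) * erfc (- r k * of_real (sqrt t))"
      by (simp add: A_def)
  qed
  finally show ?thesis
    unfolding q_def homogeneous_series[OF t] by (rule sym)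
qed

end

theorem theorem8:
  fixes a b c y0 y1 :: real and n :: nat and C \<alpha> :: "nat \<Rightarrow> real"
  assumes "card {r. poly (bt_poly a b c) r = 0} = 4"
  defines "f \<equiv> \<lambda>t. \<Sum>l=0..n. C l * t powr \<alpha> l"
  shows "bij_betw (bt_root a b c) {1..4} {r. poly (bt_poly a b c) r = 0} \<and>
    ((\<forall>l\<le>n. \<alpha> l > -1) \<longrightarrow> (\<exists>y. bagley_torvik_solution a b c f y0 y1 y)) \<and>
    (\<forall>y. bagley_torvik_solution a b c f y0 y1 y \<longrightarrow>
       (\<forall>t>0. complex_of_real (y t) = bt_forced a b c n C \<alpha> t + bt_complementary a b c y0 y1 t))"
proof (intro conjI impI allI)
  interpret bt_coefficients a b c "bt_coeff a b c" by (rule bt_coefficients_bt_coeff[OF assms(1)])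
  show "bij_betw (bt_root a b c) {1..4} {r. poly (bt_poly a b c) r = 0}" by (rule bt_root_bij[OF assms(1)])
  show "\<exists>y. bagley_torvik_solution a b c f y0 y1 y" if "\<forall>l\<le>n. \<alpha> l > -1"
    unfolding f_def using explicit_solution[of "{0..n}" \<alpha> C y0 y1] that by auto
  fix y and t :: real
  assume y: "bagley_torvik_solution a b c f y0 y1 y" and t: "t > 0"
  define A where "A = {l \<in> {0..n}. \<alpha> l > -1}"
  \<comment> \<open>The solution \<open>y\<close> forces the source to be integrable near \<open>0\<close>, which only leaves exponents above \<open>-1\<close>.\<close>
  have "(\<Sum>l | l \<in> {0..n} \<and> \<alpha> l = x. C l) = 0" if x: "x \<in> \<alpha> ` {0..n}" "\<not> x > -1" for x
  proof -
    have "f t = (\<Sum>x\<in>\<alpha> ` {0..n}. (\<Sum>l | l \<in> {0..n} \<and> \<alpha> l = x. C l) * t powr x)" for t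
      unfolding f_def sum_distrib_right by (subst sum.image_gen[of _ _ \<alpha>]) (auto intro!: sum.cong)
    then show ?thesis
      using power_sum_integrable_near_0[of "\<alpha> ` {0..n}" "\<lambda>x. \<Sum>l | l \<in> {0..n} \<and> \<alpha> l = x. C l" x]
        bagley_torvik_solution_rhs_integrable[OF y] x by simp
  qed
  \<comment> \<open>Used below both for the source and for the formula, so the function of the exponent stays general.\<close>
  note vanish = sum_group_vanish[where P = "\<lambda>x. x > -1", OF finite_atLeastAtMost this, folded A_def]
  have "f s = (\<Sum>l\<in>A. C l * s powr \<alpha> l)" for s
    using vanish[where \<phi> = "\<lambda>x. s powr x"] by (simp add: f_def)
  with y have y': "bagley_torvik_solution a b c (\<lambda>t. \<Sum>l\<in>A. C l * t powr \<alpha> l) y0 y1 y"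
    by (rule bagley_torvik_solution_cong)
  have "y t = (\<Sum>l\<in>A. C l * Gamma (\<alpha> l + 1) * frac_series (bt_coeff a b c) (\<alpha> l + 1/2) t) +
      (y0 + y1 * t - c * y0 * frac_series (bt_coeff a b c) (1/2) t - c * y1 * frac_series (bt_coeff a b c) (3/2) t)"
    by (rule bagley_torvik_solution_unique[OF y' explicit_solution bt_poly_4_roots_nonzero(1)[OF assms(1)] t])
       (auto simp: A_def)
  then show "complex_of_real (y t) = bt_forced a b c n C \<alpha> t + bt_complementary a b c y0 y1 t"
    unfolding bt_complementary_eq_frac_series[OF assms(1) t] bt_forced_eq_frac_series[OF assms(1) t]
    using vanish[where \<phi> = "\<lambda>x. complex_of_real (Gamma (x + 1) * frac_series (bt_coeff a b c) (x + 1/2) t)"]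
    by (simp add: mult.assoc)
qed

end
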